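(* Let $X$ be a nonempty set and $X/\mathrm{AC}=\{[x]_{\mathrm{AC}}\mid x\in X\}$. (a) $\mathsf{N}_{\mathrm{rd}}[X]=(\mathbb{N}_{\mathrm{rd}}[X],+,\times_{\mathrm{rd}},0,1)$ is a free right-distributive strong bimonoid, freely generated (in the class of all right-distributive strong bimonoids) by $X/\mathrm{AC}$. (b) $\mathsf{B}_{\mathrm{id,rd}}[X]=(\mathbb{B}_{\mathrm{id,rd}}[X],+_{\mathrm{id}},\times_{\mathrm{rd}},0,1)$ is a free idempotent right-distributive strong bimonoid, freely generated (in the class of all idempotent right-distributive strong bimonoids) by $X/\mathrm{AC}$.
   Context: A strong bimonoid is an algebra $(B,\oplus,\otimes,\mathbf 0,\mathbf 1)$ such that $(B,\oplus,\mathbf 0)$ is a commutative monoid, $(B,\otimes,\mathbf 1)$ is a monoid, and $b\otimes\mathbf 0=\mathbf 0\otimes b=\mathbf 0$ for all $b$. It is right-distributive if $(a\oplus b)\otimes c=(a\otimes c)\oplus(b\otimes c)$ for all $a,b,c$, and idempotent if $b\oplus b=b$ for all $b$. Homomorphisms preserve both operations and both constants. An algebra $F$ in a class $\mathcal K$ is freely generated in $\mathcal K$ by $Y\subseteq F$ if $Y$ generates $F$ (using the operations and constants) and every map $Y\to A$ with $A\in\mathcal K$ extends to a homomorphism $F\to A$. Terms. $\mathrm{T}(X)$ is the set of all terms built from elements of $X$, constants $\hat 0,\hat 1$, and binary symbols $\hat+,\hat\times$ (infix). $\mathrm{size}(t)$ is the total number of occurrences of symbols (elements of $X$, constants, binary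 symbols) in $t$. Simple terms. $s\in \mathrm{T}(X)$ is simple if $s=\hat 0$, or $s$ contains neither $\hat 0$ nor any subterm of the form $\hat 1\hat\times s'$ or $s'\hat\times\hat 1$. $\mathrm{ST}(X)$ is the set of simple terms. For $s,t\in \mathrm{ST}(X)$, $s=_{\mathrm{AC}}t$ means that $t$ is obtained from $s$ by finitely many steps, each replacing a subterm occurrence using, in either direction, one of: $a\hat+(b\hat+c)\leftrightarrow(a\hat+b)\hat+c$, $a\hat+b\leftrightarrow b\hat+a$, $a\hat\times(b\hat\times c)\leftrightarrow(a\hat\times b)\hat\times c$. $[s]_{\mathrm{AC}}$ is the class of $s$; $\mathbb{N}_{\mathrm{sb}}[X]=\mathrm{ST}(X)/{=_{\mathrm{AC}}}$; $0=[\hat 0]_{\mathrm{AC}}$, $1=[\hat 1]_{\mathrm{AC}}$; $\mathrm{size}([s]_{\mathrm{AC}})=\mathrm{size}(s)$ (well defined). Operations on $\mathbb{N}_{\mathrm{sb}}[X]$: $p+0=0+p=p$, and $[s]_{\mathrm{AC}}+[t]_{\mathrm{AC}}=[s\hat+t]_{\mathrm{AC}}$ for $s,t\neq\hat 0$; $p\times 0=0\times p=0$, $p\times1=1\times p=p$, and $[s]_{\mathrm{AC}}\times[t]_{\mathrm{AC}}=[s\hat\times t]_{\mathrm{AC}}$ for $s,t\notin\{\hat 0,\hat 1\}$. Polynomials. A monomial term is a term built from elements of $X$ using only $\hat\times$; a monomial is the class of a monomial term. The set $\mathrm{PT}(X)$ of polynomial terms is the smallest $U\subseteq \mathrm{ST}(X)$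 with: (a) $\hat 0,\hat 1$ and all monomial terms are in $U$; (b) if $s,t\in U\setminus\{\hat 0\}$ then $s\hat+t\in U$; (c) if $s$ is a monomial term and $t\in U\setminus\{\hat 0,\hat 1\}$ then $s\hat\times t\in U$. Terms arising by (b) (resp. (c)) are sum (resp. product) polynomial terms. $\mathbb{N}_{\mathrm{rd}}[X]=\{[t]_{\mathrm{AC}}\mid t\in \mathrm{PT}(X)\}$ (polynomials), closed under $+$; classes of sum (product) polynomial terms are sum (product) polynomials. Facts making the next definition meaningful: every polynomial outside $X/\mathrm{AC}\cup\{0,1\}$ is exactly one of a sum polynomial or a product polynomial; each sum polynomial is $q_1+\dots+q_n$ with $n\ge2$ and each $q_i$ a product polynomial or in $X/\mathrm{AC}\cup\{1\}$, uniquely up to permutation; each product polynomial that is not a monomial is $m\times q'$ for a unique monomial $m$ and unique sum polynomial $q'$. Multiplication $\times_{\mathrm{rd}}$ on $\mathbb{N}_{\mathrm{rd}}[X]$, by induction on $\mathrm{size}(q)$: $q\times_{\mathrm{rd}}0=0\times_{\mathrm{rd}}q=0$, $q\times_{\mathrm{rd}}1=1\times_{\mathrm{rd}}q=q$; for $q,r\notin\{0,1\}$: if $q$ is a monomial, $q\times_{\mathrm{rd}}r=q\times r$; if $q$ is a sum polynomial, written as $q=q_1+\dots+q_n$ with $n\ge2$ and each $q_i$ a product polynomial or in $X/\mathrm{AC}\cup\{1\}$, $q\times_{\mathrm{rd}}r=q_1\times_{\mathrm{rd}}r+\dots+q_n\times_{\mathrm{rd}}r$; if $q=m\times q'$ with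 $m$ a monomial and $q'$ a sum polynomial, $q\times_{\mathrm{rd}}r=m\times(q'\times_{\mathrm{rd}}r)$. Id-reduced polynomials. A sum term is a simple term $s_1\hat+s_2$ with $s_1,s_2\in \mathrm{ST}(X)\setminus\{\hat 0\}$; a product term is a simple term $s_1\hat\times s_2$ with $s_1,s_2\in \mathrm{ST}(X)\setminus\{\hat0,\hat1\}$. Each sum term is, up to omitted parentheses, uniquely $t_1\hat+\cdots\hat+t_n$ ($n\ge2$) with every $t_i$ a product term or in $X\cup\{\hat 1\}$ (its sum-product decomposition). $\mathrm{ST}_{\mathrm{id}}(X)$ is the smallest $U\subseteq \mathrm{ST}(X)$ with: (a) $\hat0,\hat1$ and all monomial terms are in $U$; (b) if $t$ is a sum term with sum-product decomposition $t_1\hat+\cdots\hat+t_n$, all $t_i\in U$, and $t_i\neq_{\mathrm{AC}}t_j$ for $i<j$, then $t\in U$; (c) if $s,t\in U\setminus\{\hat0,\hat1\}$ then $s\hat\times t\in U$. $\mathrm{PT}_{\mathrm{id}}(X)=\mathrm{PT}(X)\cap \mathrm{ST}_{\mathrm{id}}(X)$, and $\mathbb{B}_{\mathrm{id,rd}}[X]=\{[t]_{\mathrm{AC}}\mid t\in \mathrm{PT}_{\mathrm{id}}(X)\}\subseteq\mathbb{N}_{\mathrm{rd}}[X]$ is the set of id-reduced polynomials; it is closed under $\times_{\mathrm{rd}}$. Addition $+_{\mathrm{id}}$ on $\mathbb{B}_{\mathrm{id,rd}}[X]$: $q+_{\mathrm{id}}0=0+_{\mathrm{id}}q=q$. For $q,r\ne0$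 write $q=q_1+\dots+q_k$ and $r=r_1+\dots+r_n$ ($k,n\ge1$) with the $q_i$ pairwise different, the $r_j$ pairwise different, each being $1$, a monomial, or an id-reduced product polynomial; then $q+_{\mathrm{id}}r=q_1+\dots+q_k+r_{i_1}+\dots+r_{i_\ell}$ where $\{i_1,\dots,i_\ell\}$ is the maximal subset of $\{1,\dots,n\}$ with $\{q_1,\dots,q_k\}\cap\{r_{i_1},\dots,r_{i_\ell}\}=\emptyset$. *)

theory Defs
  imports "HOL-Algebra.Ring"
begin

section \<open>Strong bimonoids and free generation\<close>

text \<open>Algebras are records of HOL-Algebra's ring signature.\<close>

locale strong_bimonoid = abelian_monoid R + monoid R for R (structure) +
  assumes zero_mult: "b \<in> carrier R \<Longrightarrow> \<zero> \<otimes> b = \<zero>"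
    and mult_zero: "b \<in> carrier R \<Longrightarrow> b \<otimes> \<zero> = \<zero>"

locale rd_strong_bimonoid = strong_bimonoid +
  assumes right_distr:
    "\<lbrakk> a \<in> carrier R; b \<in> carrier R; c \<in> carrier R \<rbrakk> \<Longrightarrow> (a \<oplus> b) \<otimes> c = (a \<otimes> c) \<oplus> (b \<otimes> c)"

locale idem_rd_strong_bimonoid = rd_strong_bimonoid +
  assumes add_idem: "b \<in> carrier R \<Longrightarrow> b \<oplus> b = b"

text \<open>\<^const>\<open>ring_hom\<close> does not require preservation of zero.\<close>

definition sb_hom :: "('a, 'm) ring_scheme \<Rightarrow> ('b, 'n) ring_scheme \<Rightarrow> ('a \<Rightarrow> 'b) set" where
  "sb_hom R S = {h \<in> ring_hom R S. h \<zero>\<^bsub>R\<^esub> = \<zero>\<^bsub>S\<^esub>}"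

inductive_set sb_generate :: "('a, 'm) ring_scheme \<Rightarrow> 'a set \<Rightarrow> 'a set"
  for F :: "('a, 'm) ring_scheme" (structure) and Y :: "'a set" where
  base: "y \<in> Y \<Longrightarrow> y \<in> sb_generate F Y"
| zero: "\<zero> \<in> sb_generate F Y"
| one: "\<one> \<in> sb_generate F Y"
| add: "a \<in> sb_generate F Y \<Longrightarrow> b \<in> sb_generate F Y \<Longrightarrow> a \<oplus> b \<in> sb_generate F Y"
| mult: "a \<in> sb_generate F Y \<Longrightarrow> b \<in> sb_generate F Y \<Longrightarrow> a \<otimes> b \<in> sb_generate F Y"

text \<open>
  The class \<open>K\<close> is given at the type \<open>'b\<close> of the target algebras, which need not be the
  element type of \<open>F\<close>.  Hence membership of \<open>F\<close> in the class has to be stated separately,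
  and a theorem about \<open>freely_generated\<close> should leave \<open>'b\<close> polymorphic.
\<close>

definition freely_generated :: "('b ring \<Rightarrow> bool) \<Rightarrow> 'a ring \<Rightarrow> 'a set \<Rightarrow> bool" where
  "freely_generated K F Y \<longleftrightarrow>
     Y \<subseteq> carrier F \<and> sb_generate F Y = carrier F \<and>
     (\<forall>A f. K A \<longrightarrow> f \<in> Y \<rightarrow> carrier A \<longrightarrow> (\<exists>h\<in>sb_hom F A. \<forall>y\<in>Y. h y = f y))"


section \<open>Terms, simple terms and AC-equality\<close>

datatype (tvars: 'x) trm =
    Var 'x
  | Hat0
  | Hat1
  | HPlus "'x trm" "'x trm" (infixl \<open>\<^bold>+\<close> 65)
  | HTimes "'x trm" "'x trm" (infixl \<open>\<^bold>*\<close> 70)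

primrec term_size :: "'x trm \<Rightarrow> nat" where
  "term_size (Var x) = 1"
| "term_size Hat0 = 1"
| "term_size Hat1 = 1"
| "term_size (s \<^bold>+ t) = term_size s + term_size t + 1"
| "term_size (s \<^bold>* t) = term_size s + term_size t + 1"

primrec subterms :: "'x trm \<Rightarrow> 'x trm set" where
  "subterms (Var x) = {Var x}"
| "subterms Hat0 = {Hat0}"
| "subterms Hat1 = {Hat1}"
| "subterms (s \<^bold>+ t) = {s \<^bold>+ t} \<union> subterms s \<union> subterms t"
| "subterms (s \<^bold>* t) = {s \<^bold>* t} \<union> subterms s \<union> subterms t"

definition terms :: "'x set \<Rightarrow> 'x trm set" where
  "terms X = {t. tvars t \<subseteq> X}"

definition ST :: "'x set \<Rightarrow> 'x trm set" where
  "ST X = {s \<in> terms X. s = Hat0 \<or>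
     (Hat0 \<notin> subterms s \<and> (\<forall>s'. Hat1 \<^bold>* s' \<notin> subterms s \<and> s' \<^bold>* Hat1 \<notin> subterms s))}"

inductive ac_step :: "'x trm \<Rightarrow> 'x trm \<Rightarrow> bool" where
  plus_assoc: "ac_step (a \<^bold>+ (b \<^bold>+ c)) ((a \<^bold>+ b) \<^bold>+ c)"
| plus_comm: "ac_step (a \<^bold>+ b) (b \<^bold>+ a)"
| times_assoc: "ac_step (a \<^bold>* (b \<^bold>* c)) ((a \<^bold>* b) \<^bold>* c)"
| plus_left: "ac_step a a' \<Longrightarrow> ac_step (a \<^bold>+ b) (a' \<^bold>+ b)"
| plus_right: "ac_step b b' \<Longrightarrow> ac_step (a \<^bold>+ b) (a \<^bold>+ b')"
| times_left: "ac_step a a' \<Longrightarrow> ac_step (a \<^bold>* b) (a' \<^bold>* b)"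
| times_right: "ac_step b b' \<Longrightarrow> ac_step (a \<^bold>* b) (a \<^bold>* b')"

definition ac_eq :: "'x trm \<Rightarrow> 'x trm \<Rightarrow> bool" (infix \<open>=\<^sub>A\<^sub>C\<close> 50) where
  "s =\<^sub>A\<^sub>C t \<longleftrightarrow> equivclp ac_step s t"

text \<open>
  The class of a term is taken in the set of all terms; for a simple term over \<open>X\<close> it
  consists of simple terms over \<open>X\<close> only (lemma \<open>ac_class_ST\<close> below), so that it is the
  class in \<open>ST X\<close>.
\<close>

definition ac_class :: "'x trm \<Rightarrow> 'x trm set" (\<open>[_]\<^sub>A\<^sub>C\<close>) where
  "[s]\<^sub>A\<^sub>C = {t. s =\<^sub>A\<^sub>C t}"

definition class_size :: "'x trm set \<Rightarrow> nat" where
  "class_size p = the_elem (term_size ` p)"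

abbreviation sb_zero :: "'x trm set" where "sb_zero \<equiv> [Hat0]\<^sub>A\<^sub>C"
abbreviation sb_one :: "'x trm set" where "sb_one \<equiv> [Hat1]\<^sub>A\<^sub>C"

definition sb_add :: "'x trm set \<Rightarrow> 'x trm set \<Rightarrow> 'x trm set" where
  "sb_add p q =
     (if p = sb_zero then q else if q = sb_zero then p
      else (\<Union>s\<in>p. \<Union>t\<in>q. [s \<^bold>+ t]\<^sub>A\<^sub>C))"

definition sb_mult :: "'x trm set \<Rightarrow> 'x trm set \<Rightarrow> 'x trm set" where
  "sb_mult p q =
     (if p = sb_zero \<or> q = sb_zero then sb_zero
      else if p = sb_one then q else if q = sb_one then p
      else (\<Union>s\<in>p. \<Union>t\<in>q. [s \<^bold>* t]\<^sub>A\<^sub>C))"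

definition sb_sum :: "'x trm set list \<Rightarrow> 'x trm set" where
  "sb_sum qs = foldr sb_add qs sb_zero"

definition gens :: "'x set \<Rightarrow> 'x trm set set" where
  "gens X = {[Var x]\<^sub>A\<^sub>C | x. x \<in> X}"


section \<open>Polynomials\<close>

inductive_set MT :: "'x set \<Rightarrow> 'x trm set" for X :: "'x set" where
  "x \<in> X \<Longrightarrow> Var x \<in> MT X"
| "s \<in> MT X \<Longrightarrow> t \<in> MT X \<Longrightarrow> s \<^bold>* t \<in> MT X"

inductive_set PT :: "'x set \<Rightarrow> 'x trm set" for X :: "'x set" where
  zero: "Hat0 \<in> PT X"
| one: "Hat1 \<in> PT X"
| monomial: "t \<in> MT X \<Longrightarrow> t \<in> PT X"
| sum: "s \<in> PT X \<Longrightarrow> s \<noteq> Hat0 \<Longrightarrow> t \<in> PT X \<Longrightarrow> t \<noteq> Hat0 \<Longrightarrow> s \<^bold>+ t \<in> PT X"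
| product: "s \<in> MT X \<Longrightarrow> t \<in> PT X \<Longrightarrow> t \<noteq> Hat0 \<Longrightarrow> t \<noteq> Hat1 \<Longrightarrow> s \<^bold>* t \<in> PT X"

text \<open>The least set closed under the rules is contained in \<open>ST X\<close>.\<close>

lemma ST_plus: "s \<in> ST X - {Hat0} \<Longrightarrow> t \<in> ST X - {Hat0} \<Longrightarrow> s \<^bold>+ t \<in> ST X"
  by (auto simp: ST_def terms_def)

lemma ST_times: "s \<in> ST X - {Hat0, Hat1} \<Longrightarrow> t \<in> ST X - {Hat0, Hat1} \<Longrightarrow> s \<^bold>* t \<in> ST X"
  by (auto simp: ST_def terms_def)

lemma MT_ST: "t \<in> MT X \<Longrightarrow> t \<in> ST X - {Hat0, Hat1}"
proof (induction rule: MT.induct)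
  case (1 x)
  then show ?case by (simp add: ST_def terms_def)
next
  case (2 s t)
  then show ?case using ST_times[of s X t] by simp
qed

lemma PT_ST: "t \<in> PT X \<Longrightarrow> t \<in> ST X"
proof (induction rule: PT.induct)
  case (product s t)
  then show ?case using MT_ST[of s X] ST_times[of s X t] by simp
next
  case (monomial t)
  then show ?case using MT_ST by blast
next
  case (sum s t)
  then show ?case by (intro ST_plus) auto
qed (auto simp: ST_def terms_def)

definition polynomials :: "'x set \<Rightarrow> 'x trm set set" where
  "polynomials X = ac_class ` PT X"

definition monomials :: "'x set \<Rightarrow> 'x trm set set" where
  "monomials X = ac_class ` MT X"

definition sum_polynomials :: "'x set \<Rightarrow> 'x trm set set" where
  "sum_polynomials X = {[s \<^bold>+ t]\<^sub>A\<^sub>C | s t. s \<in> PT X - {Hat0} \<and> t \<in> PT X - {Hat0}}"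

definition product_polynomials :: "'x set \<Rightarrow> 'x trm set set" where
  "product_polynomials X = {[s \<^bold>* t]\<^sub>A\<^sub>C | s t. s \<in> MT X \<and> t \<in> PT X - {Hat0, Hat1}}"

text \<open>
  The two decompositions below are determined by the polynomial (for sums: up to the order
  of the summands), so nothing depends on the choice made by \<open>SOME\<close>.
\<close>

definition sum_decomp :: "'x set \<Rightarrow> 'x trm set \<Rightarrow> 'x trm set list" where
  "sum_decomp X q =
     (SOME qs. length qs \<ge> 2 \<and> set qs \<subseteq> product_polynomials X \<union> gens X \<union> {sb_one} \<and>
        sb_sum qs = q)"

definition prod_decomp :: "'x set \<Rightarrow> 'x trm set \<Rightarrow> 'x trm set \<times> 'x trm set" where
  "prod_decomp X q =
     (SOME (m, q'). m \<in> monomials X \<and> q' \<in> sum_polynomials X \<and> q = sb_mult m q')"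


subsection \<open>Facts needed for the recursive definition of multiplication\<close>

lemma ac_eq_refl: "s =\<^sub>A\<^sub>C s"
  by (simp add: ac_eq_def)

lemma ac_eq_sym: "s =\<^sub>A\<^sub>C t \<Longrightarrow> t =\<^sub>A\<^sub>C s"
  unfolding ac_eq_def by (rule equivclp_sym)

lemma ac_eq_trans: "s =\<^sub>A\<^sub>C t \<Longrightarrow> t =\<^sub>A\<^sub>C u \<Longrightarrow> s =\<^sub>A\<^sub>C u"
  unfolding ac_eq_def by (rule equivclp_trans)

lemma ac_step_imp_ac_eq: "ac_step s t \<Longrightarrow> s =\<^sub>A\<^sub>C t"
  unfolding ac_eq_def by (rule r_into_equivclp)

lemma ac_eq_invariant:
  assumes "s =\<^sub>A\<^sub>C t" and "\<And>u v. ac_step u v \<Longrightarrow> f u = f v"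
  shows "f s = f t"
  using assms(1) unfolding ac_eq_def
  by (induction rule: equivclp_induct) (auto dest: assms(2))

lemma ac_eq_map:
  assumes "s =\<^sub>A\<^sub>C t" and "\<And>u v. ac_step u v \<Longrightarrow> ac_step (f u) (f v)"
  shows "f s =\<^sub>A\<^sub>C f t"
  using assms(1) unfolding ac_eq_def
proof (induction rule: equivclp_induct)
  case base
  show ?case by simp
next
  case (step y z)
  then show ?case
    by (metis ac_eq_def ac_eq_sym ac_eq_trans ac_step_imp_ac_eq assms(2))
qed

lemma ac_eq_plus: "s =\<^sub>A\<^sub>C s' \<Longrightarrow> t =\<^sub>A\<^sub>C t' \<Longrightarrow> s \<^bold>+ t =\<^sub>A\<^sub>C s' \<^bold>+ t'"
  using ac_eq_map[of s s' "\<lambda>u. u \<^bold>+ t"] ac_eq_map[of t t' "\<lambda>u. s' \<^bold>+ u"]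
  by (meson ac_eq_trans ac_step.plus_left ac_step.plus_right)

lemma ac_eq_times: "s =\<^sub>A\<^sub>C s' \<Longrightarrow> t =\<^sub>A\<^sub>C t' \<Longrightarrow> s \<^bold>* t =\<^sub>A\<^sub>C s' \<^bold>* t'"
  using ac_eq_map[of s s' "\<lambda>u. u \<^bold>* t"] ac_eq_map[of t t' "\<lambda>u. s' \<^bold>* u"]
  by (meson ac_eq_trans ac_step.times_left ac_step.times_right)

lemma ac_class_eq_iff: "[s]\<^sub>A\<^sub>C = [t]\<^sub>A\<^sub>C \<longleftrightarrow> s =\<^sub>A\<^sub>C t"
  unfolding ac_class_def by (blast intro: ac_eq_refl ac_eq_sym ac_eq_trans)

lemma ac_step_tvars: "ac_step s t \<Longrightarrow> tvars s = tvars t"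
  by (induction rule: ac_step.induct) auto

lemma ac_step_Hat0: "ac_step s t \<Longrightarrow> (s = Hat0) = (t = Hat0)"
  by (induction rule: ac_step.induct) auto

lemma ac_step_Hat1: "ac_step s t \<Longrightarrow> (s = Hat1) = (t = Hat1)"
  by (induction rule: ac_step.induct) auto

lemma ac_step_subterms_Hat0: "ac_step s t \<Longrightarrow> (Hat0 \<in> subterms s) = (Hat0 \<in> subterms t)"
  by (induction rule: ac_step.induct) auto

lemma unit_factor_simps:
  "(\<exists>u. Hat1 \<^bold>* u \<in> subterms (s \<^bold>+ t) \<or> u \<^bold>* Hat1 \<in> subterms (s \<^bold>+ t)) \<longleftrightarrow>
   (\<exists>u. Hat1 \<^bold>* u \<in> subterms s \<or> u \<^bold>* Hat1 \<in> subterms s) \<or>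
   (\<exists>u. Hat1 \<^bold>* u \<in> subterms t \<or> u \<^bold>* Hat1 \<in> subterms t)"
  "(\<exists>u. Hat1 \<^bold>* u \<in> subterms (s \<^bold>* t) \<or> u \<^bold>* Hat1 \<in> subterms (s \<^bold>* t)) \<longleftrightarrow>
   s = Hat1 \<or> t = Hat1 \<or>
   (\<exists>u. Hat1 \<^bold>* u \<in> subterms s \<or> u \<^bold>* Hat1 \<in> subterms s) \<or>
   (\<exists>u. Hat1 \<^bold>* u \<in> subterms t \<or> u \<^bold>* Hat1 \<in> subterms t)"
  by auto

lemma ac_step_simple:
  "ac_step s t \<Longrightarrow>
   (\<exists>u. Hat1 \<^bold>* u \<in> subterms s \<or> u \<^bold>* Hat1 \<in> subterms s) =
   (\<exists>u. Hat1 \<^bold>* u \<in> subterms t \<or> u \<^bold>* Hat1 \<in> subterms t)"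
proof (induction rule: ac_step.induct)
  case (times_left a a' b)
  then show ?case using ac_step_Hat1[OF times_left.hyps] by (simp only: unit_factor_simps)
next
  case (times_right b b' a)
  then show ?case using ac_step_Hat1[OF times_right.hyps] by (simp only: unit_factor_simps)
qed (simp only: unit_factor_simps trm.distinct; blast)+

lemma ac_step_ST: "ac_step s t \<Longrightarrow> (s \<in> ST X) = (t \<in> ST X)"
  using ac_step_tvars[of s t] ac_step_Hat0[of s t] ac_step_subterms_Hat0[of s t]
    ac_step_simple[of s t]
  unfolding ST_def terms_def by blast

lemma ac_class_ST: "s \<in> ST X \<Longrightarrow> [s]\<^sub>A\<^sub>C = {t \<in> ST X. s =\<^sub>A\<^sub>C t}"
  unfolding ac_class_def
  using ac_eq_invariant[of s _ "\<lambda>u. u \<in> ST X"] ac_step_ST by blast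

lemma ac_eq_size: "s =\<^sub>A\<^sub>C t \<Longrightarrow> term_size s = term_size t"
proof (erule ac_eq_invariant)
  fix u v :: "'a trm"
  assume "ac_step u v"
  then show "term_size u = term_size v"
    by (induction rule: ac_step.induct) auto
qed

lemma class_size_class [simp]: "class_size [s]\<^sub>A\<^sub>C = term_size s"
proof -
  have "term_size ` [s]\<^sub>A\<^sub>C = {term_size s}"
    unfolding ac_class_def using ac_eq_size ac_eq_refl by fastforce
  then show ?thesis
    by (simp add: class_size_def)
qed

lemma class_eq_zero_iff [simp]: "[s]\<^sub>A\<^sub>C = sb_zero \<longleftrightarrow> s = Hat0"
  using ac_eq_invariant[of s Hat0 "\<lambda>u. u = Hat0"] ac_step_Hat0 ac_class_eq_iff by blast

lemma class_eq_one_iff [simp]: "[s]\<^sub>A\<^sub>C = sb_one \<longleftrightarrow> s = Hat1"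
  using ac_eq_invariant[of s Hat1 "\<lambda>u. u = Hat1"] ac_step_Hat1 ac_class_eq_iff by blast

lemma sb_add_zero [simp]: "sb_add p sb_zero = p" "sb_add sb_zero p = p"
  by (auto simp: sb_add_def)

lemma sb_add_class:
  assumes "s \<noteq> Hat0" "t \<noteq> Hat0"
  shows "sb_add [s]\<^sub>A\<^sub>C [t]\<^sub>A\<^sub>C = [s \<^bold>+ t]\<^sub>A\<^sub>C"
proof -
  have "[s' \<^bold>+ t']\<^sub>A\<^sub>C = [s \<^bold>+ t]\<^sub>A\<^sub>C" if "s' \<in> [s]\<^sub>A\<^sub>C" "t' \<in> [t]\<^sub>A\<^sub>C" for s' t'
    using that unfolding ac_class_eq_iff by (auto simp: ac_class_def intro: ac_eq_plus ac_eq_sym)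
  moreover have "s \<in> [s]\<^sub>A\<^sub>C" "t \<in> [t]\<^sub>A\<^sub>C"
    by (auto simp: ac_class_def ac_eq_refl)
  ultimately have "(\<Union>s'\<in>[s]\<^sub>A\<^sub>C. \<Union>t'\<in>[t]\<^sub>A\<^sub>C. [s' \<^bold>+ t']\<^sub>A\<^sub>C) = [s \<^bold>+ t]\<^sub>A\<^sub>C"
    by blast
  with assms show ?thesis
    by (simp add: sb_add_def)
qed

lemma sb_mult_class:
  assumes "s \<noteq> Hat0" "t \<noteq> Hat0" "s \<noteq> Hat1" "t \<noteq> Hat1"
  shows "sb_mult [s]\<^sub>A\<^sub>C [t]\<^sub>A\<^sub>C = [s \<^bold>* t]\<^sub>A\<^sub>C"
proof -
  have "[s' \<^bold>* t']\<^sub>A\<^sub>C = [s \<^bold>* t]\<^sub>A\<^sub>C" if "s' \<in> [s]\<^sub>A\<^sub>C" "t' \<in> [t]\<^sub>A\<^sub>C" for s' t'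
    using that unfolding ac_class_eq_iff by (auto simp: ac_class_def intro: ac_eq_times ac_eq_sym)
  moreover have "s \<in> [s]\<^sub>A\<^sub>C" "t \<in> [t]\<^sub>A\<^sub>C"
    by (auto simp: ac_class_def ac_eq_refl)
  ultimately have "(\<Union>s'\<in>[s]\<^sub>A\<^sub>C. \<Union>t'\<in>[t]\<^sub>A\<^sub>C. [s' \<^bold>* t']\<^sub>A\<^sub>C) = [s \<^bold>* t]\<^sub>A\<^sub>C"
    by blast
  with assms show ?thesis
    by (simp add: sb_mult_def)
qed

lemma sb_sum_simps [simp]: "sb_sum [] = sb_zero" "sb_sum (q # qs) = sb_add q (sb_sum qs)"
  by (simp_all add: sb_sum_def)

lemma sb_sum_classes:
  assumes "ts \<noteq> []" "Hat0 \<notin> set ts"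
  shows "\<exists>t. t \<noteq> Hat0 \<and> sb_sum (map ac_class ts) = [t]\<^sub>A\<^sub>C \<and>
    (\<forall>u\<in>set ts. term_size u \<le> term_size t \<and> (length ts \<ge> 2 \<longrightarrow> term_size u < term_size t))"
  using assms
proof (induction ts)
  case (Cons s ts)
  show ?case
  proof (cases "ts = []")
    case True
    with Cons.prems show ?thesis by (intro exI[of _ s]) auto
  next
    case False
    with Cons obtain t where t: "t \<noteq> Hat0" "sb_sum (map ac_class ts) = [t]\<^sub>A\<^sub>C"
      "\<forall>u\<in>set ts. term_size u \<le> term_size t" by auto
    moreover have "s \<noteq> Hat0"
      using Cons.prems by auto
    ultimately have "sb_sum (map ac_class (s # ts)) = [s \<^bold>+ t]\<^sub>A\<^sub>C"
      by (simp add: sb_add_class)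
    with t show ?thesis
      by (intro exI[of _ "s \<^bold>+ t"]) auto
  qed
qed simp

lemma sb_sum_append:
  assumes "Hat0 \<notin> set ss" "Hat0 \<notin> set ts"
  shows "sb_sum (map ac_class ss @ map ac_class ts) =
    sb_add (sb_sum (map ac_class ss)) (sb_sum (map ac_class ts))"
  using assms(1)
proof (induction ss)
  case (Cons s ss)
  show ?case
  proof (cases "ss = [] \<or> ts = []")
    case True
    then show ?thesis by auto
  next
    case False
    with Cons.prems obtain u where u: "u \<noteq> Hat0" "sb_sum (map ac_class ss) = [u]\<^sub>A\<^sub>C"
      using sb_sum_classes[of ss] by auto
    from False assms obtain v where v: "v \<noteq> Hat0" "sb_sum (map ac_class ts) = [v]\<^sub>A\<^sub>C"
      using sb_sum_classes[of ts] by auto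
    have "[s \<^bold>+ (u \<^bold>+ v)]\<^sub>A\<^sub>C = [(s \<^bold>+ u) \<^bold>+ v]\<^sub>A\<^sub>C"
      unfolding ac_class_eq_iff by (intro ac_step_imp_ac_eq plus_assoc)
    moreover have "s \<noteq> Hat0"
      using Cons.prems by auto
    ultimately show ?thesis
      using Cons u v
      by (simp add: sb_add_class)
  qed
qed simp

definition sum_atom :: "'x set \<Rightarrow> 'x trm set \<Rightarrow> bool" where
  "sum_atom X q \<longleftrightarrow> q \<in> product_polynomials X \<union> gens X \<union> {sb_one}"

lemma PT_sum_atoms:
  assumes "t \<in> PT X" "t \<noteq> Hat0"
  shows "\<exists>ts. ts \<noteq> [] \<and> Hat0 \<notin> set ts \<and> (\<forall>u\<in>set ts. sum_atom X [u]\<^sub>A\<^sub>C) \<and>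
    sb_sum (map ac_class ts) = [t]\<^sub>A\<^sub>C"
  using assms
proof (induction rule: PT.induct)
  case one
  show ?case by (intro exI[of _ "[Hat1]"]) (simp add: sum_atom_def)
next
  case (monomial t)
  have "sum_atom X [t]\<^sub>A\<^sub>C"
    using monomial(1)
  proof cases
    case (1 x)
    then show ?thesis by (auto simp: sum_atom_def gens_def)
  next
    case (2 u v)
    have "v \<in> PT X - {Hat0, Hat1}"
      using 2(3) by (auto intro: PT.monomial elim: MT.cases)
    with 2 show ?thesis by (auto simp: sum_atom_def product_polynomials_def)
  qed
  with monomial show ?case by (intro exI[of _ "[t]"]) auto
next
  case (sum s t)
  then obtain ss ts where
    "ss \<noteq> []" "Hat0 \<notin> set ss" "\<forall>u\<in>set ss. sum_atom X [u]\<^sub>A\<^sub>C" "sb_sum (map ac_class ss) = [s]\<^sub>A\<^sub>C"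
    "ts \<noteq> []" "Hat0 \<notin> set ts" "\<forall>u\<in>set ts. sum_atom X [u]\<^sub>A\<^sub>C" "sb_sum (map ac_class ts) = [t]\<^sub>A\<^sub>C"
    by auto
  then show ?case
    using sum.hyps
    by (intro exI[of _ "ss @ ts"]) (auto simp: sb_sum_append sb_add_class)
next
  case (product s t)
  have "sum_atom X [s \<^bold>* t]\<^sub>A\<^sub>C"
    using product.hyps by (auto simp: sum_atom_def product_polynomials_def)
  then show ?case by (intro exI[of _ "[s \<^bold>* t]"]) auto
qed simp

lemma sum_decomp_props:
  assumes "q \<in> sum_polynomials X"
  shows "length (sum_decomp X q) \<ge> 2"
    and "set (sum_decomp X q) \<subseteq> product_polynomials X \<union> gens X \<union> {sb_one}"
    and "sb_sum (sum_decomp X q) = q"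
proof -
  from assms obtain s t where st: "s \<in> PT X" "s \<noteq> Hat0" "t \<in> PT X" "t \<noteq> Hat0" "q = [s \<^bold>+ t]\<^sub>A\<^sub>C"
    by (auto simp: sum_polynomials_def)
  obtain ss ts where *:
    "ss \<noteq> []" "Hat0 \<notin> set ss" "\<forall>u\<in>set ss. sum_atom X [u]\<^sub>A\<^sub>C" "sb_sum (map ac_class ss) = [s]\<^sub>A\<^sub>C"
    "ts \<noteq> []" "Hat0 \<notin> set ts" "\<forall>u\<in>set ts. sum_atom X [u]\<^sub>A\<^sub>C" "sb_sum (map ac_class ts) = [t]\<^sub>A\<^sub>C"
    using PT_sum_atoms[OF st(1,2)] PT_sum_atoms[OF st(3,4)] by auto
  let ?qs = "map ac_class ss @ map ac_class ts"
  have "length ?qs \<ge> 2"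
    using * by (cases ss; cases ts) auto
  moreover have "set ?qs \<subseteq> product_polynomials X \<union> gens X \<union> {sb_one}"
    using * by (auto simp: sum_atom_def)
  moreover have "sb_sum ?qs = q"
    using * st by (simp add: sb_sum_append sb_add_class)
  ultimately have "\<exists>qs. length qs \<ge> 2 \<and>
      set qs \<subseteq> product_polynomials X \<union> gens X \<union> {sb_one} \<and> sb_sum qs = q"
    by blast
  from someI_ex[OF this]
  show "length (sum_decomp X q) \<ge> 2"
    and "set (sum_decomp X q) \<subseteq> product_polynomials X \<union> gens X \<union> {sb_one}"
    and "sb_sum (sum_decomp X q) = q"
    unfolding sum_decomp_def by blast+
qed

lemma sum_decomp_size:
  assumes "q \<in> sum_polynomials X" "p \<in> set (sum_decomp X q)"
  shows "class_size p < class_size q"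
proof -
  let ?qs = "sum_decomp X q"
  have "\<exists>u. u \<noteq> Hat0 \<and> r = [u]\<^sub>A\<^sub>C" if "r \<in> set ?qs" for r
    using sum_decomp_props(2)[OF assms(1)] that
    by (fastforce simp: product_polynomials_def gens_def)
  then obtain f where f: "\<And>r. r \<in> set ?qs \<Longrightarrow> f r \<noteq> Hat0 \<and> r = [f r]\<^sub>A\<^sub>C"
    by metis
  let ?ts = "map f ?qs"
  have qs: "?qs = map ac_class ?ts"
    using f by (simp add: map_idI)
  have "?ts \<noteq> []" "Hat0 \<notin> set ?ts" "length ?ts \<ge> 2"
    using f sum_decomp_props(1)[OF assms(1)] by force+
  then obtain t where t: "sb_sum (map ac_class ?ts) = [t]\<^sub>A\<^sub>C"
      "\<forall>u\<in>set ?ts. term_size u < term_size t"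
    using sb_sum_classes[of ?ts] by metis
  have "q = [t]\<^sub>A\<^sub>C"
    using t(1) sum_decomp_props(3)[OF assms(1)] qs by simp
  moreover have "class_size p = term_size (f p)"
    using f[OF assms(2)] by (metis class_size_class)
  ultimately show ?thesis
    using t(2) assms(2) by simp
qed

lemma prod_decomp_props:
  assumes "\<exists>m\<in>monomials X. \<exists>q'\<in>sum_polynomials X. q = sb_mult m q'"
  shows "fst (prod_decomp X q) \<in> monomials X"
    and "snd (prod_decomp X q) \<in> sum_polynomials X"
    and "q = sb_mult (fst (prod_decomp X q)) (snd (prod_decomp X q))"
proof -
  have "\<exists>z. case z of (m, q') \<Rightarrow> m \<in> monomials X \<and> q' \<in> sum_polynomials X \<and> q = sb_mult m q'"
    using assms by auto
  from someI_ex[OF this]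
  show "fst (prod_decomp X q) \<in> monomials X"
    and "snd (prod_decomp X q) \<in> sum_polynomials X"
    and "q = sb_mult (fst (prod_decomp X q)) (snd (prod_decomp X q))"
    unfolding prod_decomp_def by (auto simp: case_prod_unfold)
qed

lemma prod_decomp_size:
  assumes "\<exists>m\<in>monomials X. \<exists>q'\<in>sum_polynomials X. q = sb_mult m q'"
  shows "class_size (snd (prod_decomp X q)) < class_size q"
proof -
  obtain s where s: "s \<in> MT X" "fst (prod_decomp X q) = [s]\<^sub>A\<^sub>C"
    using prod_decomp_props(1)[OF assms] by (auto simp: monomials_def)
  obtain u v where uv: "snd (prod_decomp X q) = [u \<^bold>+ v]\<^sub>A\<^sub>C"
    using prod_decomp_props(2)[OF assms] by (auto simp: sum_polynomials_def)
  have "s \<noteq> Hat0" "s \<noteq> Hat1"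
    using s(1) by (auto elim: MT.cases)
  then have "q = [s \<^bold>* (u \<^bold>+ v)]\<^sub>A\<^sub>C"
    using prod_decomp_props(3)[OF assms] by (simp add: s uv sb_mult_class)
  with uv show ?thesis by simp
qed


subsection \<open>Multiplication of polynomials\<close>

text \<open>The last branch is never reached when \<open>q\<close> is a polynomial.\<close>

function mult_rd :: "'x set \<Rightarrow> 'x trm set \<Rightarrow> 'x trm set \<Rightarrow> 'x trm set" where
  "mult_rd X q r =
     (if q = sb_zero \<or> r = sb_zero then sb_zero
      else if q = sb_one then r
      else if r = sb_one then q
      else if q \<in> monomials X then sb_mult q r
      else if q \<in> sum_polynomials X then
        sb_sum (map (\<lambda>p. mult_rd X p r) (sum_decomp X q))
      else if \<exists>m\<in>monomials X. \<exists>q'\<in>sum_polynomials X. q = sb_mult m q' then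
        sb_mult (fst (prod_decomp X q)) (mult_rd X (snd (prod_decomp X q)) r)
      else undefined)"
  by auto
termination
  by (relation "Wellfounded.measure (\<lambda>(X, q, r). class_size q)")
     (auto intro: sum_decomp_size prod_decomp_size)

declare mult_rd.simps [simp del]

definition N_rd :: "'x set \<Rightarrow> 'x trm set ring" where
  "N_rd X = \<lparr>carrier = polynomials X, mult = mult_rd X, one = sb_one,
             zero = sb_zero, add = sb_add\<rparr>"


section \<open>Id-reduced polynomials\<close>

text \<open>Applied to a sum term, this gives its sum-product decomposition.\<close>

fun summands :: "'x trm \<Rightarrow> 'x trm list" where
  "summands (s \<^bold>+ t) = summands s @ summands t"
| "summands t = [t]"

inductive_set ST_id :: "'x set \<Rightarrow> 'x trm set" for X :: "'x set" where
  zero: "Hat0 \<in> ST_id X"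
| one: "Hat1 \<in> ST_id X"
| monomial: "t \<in> MT X \<Longrightarrow> t \<in> ST_id X"
| sum: "s1 \<in> ST X - {Hat0} \<Longrightarrow> s2 \<in> ST X - {Hat0} \<Longrightarrow> ts = summands (s1 \<^bold>+ s2) \<Longrightarrow>
    \<forall>u\<in>set ts. u \<in> ST_id X \<Longrightarrow>
    \<forall>i j. i < j \<and> j < length ts \<longrightarrow> \<not> ts ! i =\<^sub>A\<^sub>C ts ! j \<Longrightarrow>
    s1 \<^bold>+ s2 \<in> ST_id X"
| product: "s \<in> ST_id X \<Longrightarrow> s \<noteq> Hat0 \<Longrightarrow> s \<noteq> Hat1 \<Longrightarrow>
    t \<in> ST_id X \<Longrightarrow> t \<noteq> Hat0 \<Longrightarrow> t \<noteq> Hat1 \<Longrightarrow> s \<^bold>* t \<in> ST_id X"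

lemma ST_id_ST: "t \<in> ST_id X \<Longrightarrow> t \<in> ST X"
proof (induction rule: ST_id.induct)
  case (monomial t)
  then show ?case using MT_ST by blast
next
  case (sum s1 s2 ts)
  then show ?case by (intro ST_plus)
next
  case (product s t)
  then show ?case by (intro ST_times) auto
qed (auto simp: ST_def terms_def)

definition PT_id :: "'x set \<Rightarrow> 'x trm set" where
  "PT_id X = PT X \<inter> ST_id X"

definition id_polynomials :: "'x set \<Rightarrow> 'x trm set set" where
  "id_polynomials X = ac_class ` PT_id X"

text \<open>Again, the decomposition is unique up to the order of the summands.\<close>

definition id_decomp :: "'x set \<Rightarrow> 'x trm set \<Rightarrow> 'x trm set list" where
  "id_decomp X q =
     (SOME qs. qs \<noteq> [] \<and> distinct qs \<and>
        set qs \<subseteq> {sb_one} \<union> monomials X \<union> (product_polynomials X \<inter> id_polynomials X) \<and>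
        sb_sum qs = q)"

definition add_id :: "'x set \<Rightarrow> 'x trm set \<Rightarrow> 'x trm set \<Rightarrow> 'x trm set" where
  "add_id X q r =
     (if q = sb_zero then r else if r = sb_zero then q
      else let qs = id_decomp X q; rs = id_decomp X r
        in sb_sum (qs @ filter (\<lambda>p. p \<notin> set qs) rs))"

definition B_id_rd :: "'x set \<Rightarrow> 'x trm set ring" where
  "B_id_rd X = \<lparr>carrier = id_polynomials X, mult = mult_rd X, one = sb_one,
                zero = sb_zero, add = add_id X\<rparr>"

end

theory Submission
  imports "HOL-Library.Multiset" Defs
begin

text \<open>
  Right distributivity lets every product be expanded from the left: a polynomial is a finite
  multiset of summands, and a summand is either \<open>1\<close> or a generator followed by a polynomial. So
  the free object should be the set of finite multisets over the datatype \<open>atom\<close> generated by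
  \<open>Unit\<close> and \<open>Lead x q\<close>, which is read as \<open>1\<close> and \<open>x * q\<close>. On multisets of atoms, addition is
  multiset sum, and \<open>q * r\<close> replaces every \<open>Unit\<close> at the end of a summand of \<open>q\<close> by \<open>r\<close>. As a
  substitution this product is associative and additive in its left argument, so \<open>nf_ring\<close> is a
  right-distributive strong bimonoid.

  Terms can be evaluated in every strong bimonoid. On polynomials evaluation respects
  AC-equality, addition and the recursively defined multiplication (\<open>class_val_mult_rd\<close>),
  because each step of the recursion is an instance of associativity, of right distributivity or
  of a law for \<open>0\<close> or \<open>1\<close>. This gives the extension of a map on the generators to a
  homomorphism. Applied to \<open>nf_ring\<close> it gives a homomorphism \<open>nf\<close>, the normal form. It is
  injective, since \<open>nf_class\<close>, which reads a multiset of atoms back as a sum of classes,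
  recovers the polynomial (\<open>nf_class_nf\<close>). A structure that embeds in a right-distributive
  strong bimonoid is one itself, which settles the axioms for \<open>N_rd\<close>.

  For the idempotent version call a multiset of atoms reduced if no atom is repeated at any
  level and no generator in it is followed by the empty multiset. The product of reduced
  multisets is reduced, because a nonzero right factor can be cancelled: products of different
  atoms with it have no summand in common (\<open>atom_mult_overlap\<close>). Reduced multisets therefore
  form an idempotent right-distributive strong bimonoid under multiset union and the same
  product. The id-reduced polynomials are exactly the polynomials with a reduced normal form
  (\<open>id_polynomials_iff\<close>), and \<open>nf\<close> turns \<open>add_id\<close> into multiset union (\<open>add_id_eq\<close>), so that
  \<open>B_id_rd\<close> embeds in this structure. A homomorphism into an idempotent target is again
  evaluation; it respects \<open>add_id\<close> because the summands common to both arguments are absorbed.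
\<close>

section \<open>Normal forms: multisets of atoms\<close>

datatype 'x atom = Unit | Lead 'x "'x atom multiset"

primrec atom_mult :: "'x atom \<Rightarrow> 'x atom multiset \<Rightarrow> 'x atom multiset" where
  "atom_mult Unit r = r"
| "atom_mult (Lead x q) r = {#Lead x (\<Sum>\<^sub># (image_mset (\<lambda>i. atom_mult i r) q))#}"

text \<open>
  Replacing \<open>Unit\<close> at the end of a summand by \<open>{#}\<close> would leave the atoms \<open>Lead x {#}\<close>, although
  \<open>x * 0 = 0\<close>. The plain substitution is therefore separated from the product \<open>nf_mult\<close>, in
  which the zero right factor is a case of its own.
\<close>

definition nf_subst :: "'x atom multiset \<Rightarrow> 'x atom multiset \<Rightarrow> 'x atom multiset" where
  "nf_subst q r = \<Sum>\<^sub># (image_mset (\<lambda>i. atom_mult i r) q)"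

definition nf_mult :: "'x atom multiset \<Rightarrow> 'x atom multiset \<Rightarrow> 'x atom multiset" where
  "nf_mult q r = (if r = {#} then {#} else nf_subst q r)"

lemma atom_mult_Lead [simp]: "atom_mult (Lead x q) r = {#Lead x (nf_subst q r)#}"
  by (simp add: nf_subst_def)

declare atom_mult.simps(2) [simp del]

lemma nf_subst_simps [simp]:
  "nf_subst {#} r = {#}"
  "nf_subst (add_mset i q) r = atom_mult i r + nf_subst q r"
  "nf_subst (p + q) r = nf_subst p r + nf_subst q r"
  by (simp_all add: nf_subst_def)

lemma set_nf_subst: "set_mset (nf_subst q r) = (\<Union>i\<in>set_mset q. set_mset (atom_mult i r))"
  by (induction q) simp_all

lemma atom_mult_nonempty: "r \<noteq> {#} \<Longrightarrow> atom_mult i r \<noteq> {#}"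
  by (cases i) simp_all

lemma nf_subst_empty_iff: "r \<noteq> {#} \<Longrightarrow> nf_subst q r = {#} \<longleftrightarrow> q = {#}"
  by (cases q) (simp_all add: atom_mult_nonempty)

text \<open>
  The induction hypothesis speaks of the atoms of \<open>p\<close>; it is lifted to \<open>p\<close> itself by induction
  on the submultisets of \<open>p\<close>.
\<close>

lemma nf_subst_atom_mult: "nf_subst (atom_mult i q) r = atom_mult i (nf_subst q r)"
proof (induction i)
  case (Lead x p)
  have "nf_subst (nf_subst p' q) r = nf_subst p' (nf_subst q r)" if "p' \<subseteq># p" for p'
    using that
  proof (induction p')
    case (add i p')
    then have "i \<in># p" "p' \<subseteq># p"
      by (auto simp: insert_subset_eq_iff intro: subset_mset.order_trans[of _ "add_mset i p'"])
    with add.IH Lead.IH show ?case by simp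
  qed simp
  then show ?case by simp
qed simp

lemma nf_subst_assoc: "nf_subst (nf_subst p q) r = nf_subst p (nf_subst q r)"
  by (induction p) (simp_all add: nf_subst_atom_mult)

lemma nf_subst_one: "nf_subst q {#Unit#} = q"
proof -
  have "atom_mult i {#Unit#} = {#i#}" for i :: "'a atom"
  proof (induction i)
    case (Lead x p)
    have "image_mset (\<lambda>i. atom_mult i {#Unit#}) p = image_mset (\<lambda>i. {#i#}) p"
      using Lead.IH by (intro image_mset_cong) auto
    then have "nf_subst p {#Unit#} = p"
      by (simp add: nf_subst_def)
    then show ?case by simp
  qed simp
  then show ?thesis
    by (simp add: nf_subst_def)
qed

text \<open>
  The carrier also contains the multisets in which some \<open>Lead x {#}\<close> occurs. The laws hold for
  them as well, since a product is empty only if one of the factors is.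
\<close>

definition nf_ring :: "'x atom multiset ring" where
  "nf_ring = \<lparr>carrier = UNIV, mult = nf_mult, one = {#Unit#}, zero = {#}, add = (+)\<rparr>"

lemma nf_mult_empty [simp]: "nf_mult {#} r = {#}" "nf_mult q {#} = {#}"
  by (simp_all add: nf_mult_def)

lemma nf_mult_one [simp]: "nf_mult q {#Unit#} = q" "nf_mult {#Unit#} q = q"
  by (simp_all add: nf_mult_def nf_subst_one)

lemma nf_mult_assoc: "nf_mult (nf_mult p q) r = nf_mult p (nf_mult q r)"
  by (simp add: nf_mult_def nf_subst_assoc nf_subst_empty_iff)

lemma nf_mult_plus: "nf_mult (p + q) r = nf_mult p r + nf_mult q r"
  by (simp add: nf_mult_def)

lemma rd_strong_bimonoid_nf_ring: "rd_strong_bimonoid nf_ring"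
  by unfold_locales (auto simp: nf_ring_def nf_mult_assoc nf_mult_plus)

section \<open>Reduced normal forms\<close>

text \<open>
  The condition \<open>q \<noteq> {#}\<close> excludes \<open>Lead x {#}\<close>. This atom is not the normal form of a
  term, and it absorbs every nonzero right factor, so that cancellation would fail for it.
\<close>

inductive reduced_atom :: "'x set \<Rightarrow> 'x atom \<Rightarrow> bool" for X :: "'x set" where
  Unit: "reduced_atom X Unit"
| Lead: "x \<in> X \<Longrightarrow> q \<noteq> {#} \<Longrightarrow> \<forall>i. count q i \<le> 1 \<Longrightarrow> \<forall>i\<in>#q. reduced_atom X i \<Longrightarrow>
    reduced_atom X (Lead x q)"

inductive_simps reduced_Lead: "reduced_atom X (Lead x q)"

definition reduced :: "'x set \<Rightarrow> 'x atom multiset \<Rightarrow> bool" where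
  "reduced X q \<longleftrightarrow> (\<forall>i. count q i \<le> 1) \<and> (\<forall>i\<in>#q. reduced_atom X i)"

lemma reduced_Lead_iff [simp]: "reduced_atom X (Lead x q) \<longleftrightarrow> x \<in> X \<and> q \<noteq> {#} \<and> reduced X q"
  by (auto simp: reduced_def reduced_Lead)

lemma reduced_add_mset:
  "reduced X (add_mset i q) \<longleftrightarrow> reduced_atom X i \<and> i \<notin># q \<and> reduced X q"
proof -
  have "(\<forall>j. count (add_mset i q) j \<le> 1) \<longleftrightarrow> count q i = 0 \<and> (\<forall>j. count q j \<le> 1)"
    (is "?L \<longleftrightarrow> ?R")
  proof
    assume L: ?L
    have "count q i = 0" using L[rule_format, of i] by simp
    moreover have "count q j \<le> 1" for j
      using L[rule_format, of j] by (cases "i = j") simp_all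
    ultimately show ?R by simp
  qed simp
  then show ?thesis
    unfolding reduced_def count_eq_zero_iff by auto
qed

lemma reduced_empty [simp]: "reduced X {#}"
  by (simp add: reduced_def)

lemma reduced_single [simp]: "reduced X {#i#} \<longleftrightarrow> reduced_atom X i"
  by (simp add: reduced_add_mset)

text \<open>
  Reduced multisets behave like sets, so an identity between them, such as right distributivity
  over unions, only has to be checked on elements.
\<close>

lemma reduced_eqI:
  assumes "reduced X p" "reduced X q" "set_mset p = set_mset q"
  shows "p = q"
proof (rule multiset_eqI)
  fix i
  have "count p i \<le> 1" "count q i \<le> 1" "count p i = 0 \<longleftrightarrow> count q i = 0"
    using assms by (simp_all add: reduced_def flip: not_in_iff)
  then show "count p i = count q i" by linarith
qed

lemma reduced_union: "reduced X p \<Longrightarrow> reduced X q \<Longrightarrow> reduced X (p \<union># q)"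
  by (auto simp: reduced_def)

lemma reduced_plus_disjoint:
  "reduced X p \<Longrightarrow> reduced X q \<Longrightarrow> set_mset p \<inter> set_mset q = {} \<Longrightarrow> reduced X (p + q)"
  unfolding reduced_def
  by (auto simp: disjoint_iff) (metis add.right_neutral add_0 not_in_iff)

text \<open>
  Multiplying \<open>r\<close> from the left by a reduced atom does not decrease its weight, and a leading
  generator increases it. This separates \<open>1 * r\<close> from \<open>(x * q) * r\<close> in the cancellation
  argument.
\<close>

primrec weight :: "'x atom \<Rightarrow> nat" where
  "weight Unit = 1"
| "weight (Lead x q) = Suc (\<Sum>\<^sub># (image_mset weight q))"

definition nf_weight :: "'x atom multiset \<Rightarrow> nat" where
  "nf_weight q = \<Sum>\<^sub># (image_mset weight q)"

lemma nf_weight_simps [simp]: "nf_weight {#} = 0"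
  "nf_weight (add_mset i q) = weight i + nf_weight q"
  "nf_weight (p + q) = nf_weight p + nf_weight q"
  "weight (Lead x q) = Suc (nf_weight q)"
  by (simp_all add: nf_weight_def)

declare weight.simps(2) [simp del]

lemma weight_le_nf_weight: "i \<in># q \<Longrightarrow> weight i \<le> nf_weight q"
  by (metis insert_DiffM le_add1 nf_weight_simps(2))

lemma nf_weight_atom_mult: "reduced_atom X i \<Longrightarrow> nf_weight r \<le> nf_weight (atom_mult i r)"
proof (induction rule: reduced_atom.induct)
  case (Lead x q)
  from \<open>q \<noteq> {#}\<close> obtain i q' where q: "q = add_mset i q'"
    by (cases q) auto
  with Lead.IH have "nf_weight r \<le> nf_weight (atom_mult i r)"
    by simp
  with q show ?case by simp
qed simp

lemma Lead_mult_not_in: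
  assumes "reduced_atom X (Lead x q)"
  shows "Lead x (nf_subst q r) \<notin># r"
proof
  assume "Lead x (nf_subst q r) \<in># r"
  from weight_le_nf_weight[OF this] have *: "Suc (nf_weight (nf_subst q r)) \<le> nf_weight r"
    by simp
  have "q \<noteq> {#}"
    using assms by simp
  then obtain i q' where q: "q = add_mset i q'"
    by (cases q) auto
  with assms have "reduced_atom X i" by (simp add: reduced_add_mset)
  from nf_weight_atom_mult[OF this, of r] * q show False by simp
qed

text \<open>
  Right cancellation, in the form needed for sums of products. The product of an atom \<open>Lead x q\<close>
  with \<open>r\<close> is the single atom \<open>Lead x (q * r)\<close>. It is too heavy to occur in \<open>1 * r = r\<close>. If it
  equals \<open>Lead y (q' * r)\<close>, then \<open>q * r = q' * r\<close>, and each atom of \<open>q\<close> shares a summand of this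
  product with some atom of \<open>q'\<close> and conversely. By induction these atoms are equal, so \<open>q\<close> and
  \<open>q'\<close> have the same elements, and being reduced they are equal.
\<close>

lemma atom_mult_overlap:
  assumes "reduced_atom X i" "reduced_atom X j" "r \<noteq> {#}"
    and "k \<in># atom_mult i r" "k \<in># atom_mult j r"
  shows "i = j"
  using assms(1,2,4,5)
proof (induction arbitrary: j k rule: reduced_atom.induct)
  case Unit
  show ?case
  proof (cases j)
    case (Lead y q')
    with Lead_mult_not_in[of X y q' r] Unit.prems show ?thesis by simp
  qed simp
next
  case (Lead x q)
  have red_i: "reduced_atom X (Lead x q)"
    using Lead.hyps Lead.IH by (simp add: reduced_def)
  show ?case
  proof (cases j)
    case Unit
    then show ?thesis using Lead_mult_not_in[OF red_i] Lead.prems by auto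
  next
    case j: (Lead y q')
    then have xy: "x = y" and eq: "nf_subst q r = nf_subst q' r"
      using Lead.prems by auto
    have red: "reduced X q" "reduced X q'"
      using red_i Lead.prems(1) j by simp_all
    have "set_mset q = set_mset q'"
    proof (intro equalityI subsetI)
      fix a assume a: "a \<in># q"
      obtain b where b: "b \<in># atom_mult a r"
        using atom_mult_nonempty[OF assms(3)] by (meson multiset_nonemptyE)
      then have "b \<in># nf_subst q' r"
        using a unfolding eq[symmetric] by (auto simp: set_nf_subst)
      then obtain c where "c \<in># q'" "b \<in># atom_mult c r"
        by (auto simp: set_nf_subst)
      with a b Lead.IH red show "a \<in># q'"
        by (metis reduced_def)
    next
      fix c assume c: "c \<in># q'"
      obtain b where b: "b \<in># atom_mult c r"
        using atom_mult_nonempty[OF assms(3)] by (meson multiset_nonemptyE)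
      then have "b \<in># nf_subst q r"
        using c unfolding eq by (auto simp: set_nf_subst)
      then obtain a where "a \<in># q" "b \<in># atom_mult a r"
        by (auto simp: set_nf_subst)
      with c b Lead.IH red show "c \<in># q"
        by (metis reduced_def)
    qed
    with red have "q = q'" by (intro reduced_eqI)
    with j xy show ?thesis by simp
  qed
qed

text \<open>
  The product is the sum of the products of single atoms, which are pairwise disjoint by
  cancellation.
\<close>

lemma reduced_nf_subst_if_atoms:
  assumes "reduced X q" "r \<noteq> {#}" "\<forall>i\<in>#q. reduced X (atom_mult i r)"
  shows "reduced X (nf_subst q r)"
  using assms(1,3)
proof (induction q)
  case (add i q)
  have "set_mset (atom_mult i r) \<inter> set_mset (nf_subst q r) = {}"
  proof (rule ccontr)
    assume "\<not> ?thesis"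
    then obtain j k where "j \<in># q" "k \<in># atom_mult i r" "k \<in># atom_mult j r"
      by (auto simp: set_nf_subst)
    moreover have "reduced_atom X i" "reduced_atom X j" "i \<notin># q"
      using add.prems(1) calculation(1) by (auto simp: reduced_add_mset) (simp add: reduced_def)
    ultimately show False
      using atom_mult_overlap[of X i j r k] assms(2) by blast
  qed
  then show ?case
    using add by (auto simp: reduced_add_mset intro: reduced_plus_disjoint)
qed simp

lemma reduced_atom_mult:
  assumes "reduced_atom X i" "reduced X r" "r \<noteq> {#}"
  shows "reduced X (atom_mult i r)"
  using assms(1)
proof (induction rule: reduced_atom.induct)
  case (Lead x q)
  then have "reduced X (nf_subst q r)"
    using assms(3) by (intro reduced_nf_subst_if_atoms) (auto simp: reduced_def)
  with Lead.hyps assms(3) show ?case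
    by (simp add: nf_subst_empty_iff)
qed (simp add: assms)

lemma reduced_nf_mult: "reduced X q \<Longrightarrow> reduced X r \<Longrightarrow> reduced X (nf_mult q r)"
  by (auto simp: nf_mult_def reduced_def[of X q]
      intro!: reduced_nf_subst_if_atoms reduced_atom_mult)

definition reduced_nf_ring :: "'x set \<Rightarrow> 'x atom multiset ring" where
  "reduced_nf_ring X =
    \<lparr>carrier = {q. reduced X q}, mult = nf_mult, one = {#Unit#}, zero = {#}, add = (\<union>#)\<rparr>"

lemma idem_rd_strong_bimonoid_reduced_nf_ring: "idem_rd_strong_bimonoid (reduced_nf_ring X)"
proof -
  have distr: "nf_mult (p \<union># q) r = nf_mult p r \<union># nf_mult q r"
    if "reduced X p" "reduced X q" "reduced X r" for p q r
    using that by (intro reduced_eqI[of X] reduced_union reduced_nf_mult)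
      (auto simp: nf_mult_def set_nf_subst)
  show ?thesis
    by unfold_locales
      (simp_all add: reduced_nf_ring_def nf_mult_assoc reduced_nf_mult reduced_union distr
        reduced_atom.Unit subset_mset.sup_assoc, simp_all add: subset_mset.sup_commute)
qed

section \<open>Evaluation of polynomials\<close>

primrec term_val :: "('b, 'm) ring_scheme \<Rightarrow> ('x \<Rightarrow> 'b) \<Rightarrow> 'x trm \<Rightarrow> 'b" where
  "term_val A f (Var x) = f x"
| "term_val A f Hat0 = \<zero>\<^bsub>A\<^esub>"
| "term_val A f Hat1 = \<one>\<^bsub>A\<^esub>"
| "term_val A f (s \<^bold>+ t) = term_val A f s \<oplus>\<^bsub>A\<^esub> term_val A f t"
| "term_val A f (s \<^bold>* t) = term_val A f s \<otimes>\<^bsub>A\<^esub> term_val A f t"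

text \<open>
  On the class of a term over \<open>X\<close> the image is a singleton, provided that \<open>f\<close> maps \<open>X\<close> into a
  right-distributive strong bimonoid \<open>A\<close> (\<open>class_val_class\<close>).
\<close>

definition class_val :: "('b, 'm) ring_scheme \<Rightarrow> ('x \<Rightarrow> 'b) \<Rightarrow> 'x trm set \<Rightarrow> 'b" where
  "class_val A f p = the_elem (term_val A f ` p)"

lemma PT_terms: "t \<in> PT X \<Longrightarrow> t \<in> terms X"
  using PT_ST by (auto simp: ST_def)

lemma MT_not_unit: "t \<in> MT X \<Longrightarrow> t \<noteq> Hat0 \<and> t \<noteq> Hat1"
  by (auto elim: MT.cases)

lemma terms_simps [simp]:
  "Var x \<in> terms X \<longleftrightarrow> x \<in> X" "Hat0 \<in> terms X" "Hat1 \<in> terms X"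
  "s \<^bold>+ t \<in> terms X \<longleftrightarrow> s \<in> terms X \<and> t \<in> terms X"
  "s \<^bold>* t \<in> terms X \<longleftrightarrow> s \<in> terms X \<and> t \<in> terms X"
  by (auto simp: terms_def)

lemma class_in_polynomials [simp, intro]: "t \<in> PT X \<Longrightarrow> [t]\<^sub>A\<^sub>C \<in> polynomials X"
  by (auto simp: polynomials_def)

lemma zero_one_in_polynomials [simp, intro]: "sb_zero \<in> polynomials X" "sb_one \<in> polynomials X"
  by (auto intro: PT.intros)

lemma gens_subset_monomials: "gens X \<subseteq> monomials X"
  by (auto simp: gens_def monomials_def intro: MT.intros)

lemma monomials_subset_polynomials: "monomials X \<subseteq> polynomials X"
  by (auto simp: monomials_def intro: PT.monomial)

lemma sum_polynomials_subset_polynomials: "sum_polynomials X \<subseteq> polynomials X"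
  by (auto simp: sum_polynomials_def intro: PT.sum)

lemma product_polynomials_subset_polynomials: "product_polynomials X \<subseteq> polynomials X"
  by (auto simp: product_polynomials_def intro: PT.product)

lemma sb_add_polynomials:
  assumes "p \<in> polynomials X" "q \<in> polynomials X"
  shows "sb_add p q \<in> polynomials X"
proof -
  obtain s t where st: "s \<in> PT X" "t \<in> PT X" and pq: "p = [s]\<^sub>A\<^sub>C" "q = [t]\<^sub>A\<^sub>C"
    using assms by (auto simp: polynomials_def)
  show ?thesis
  proof (cases "s = Hat0 \<or> t = Hat0")
    case True
    then show ?thesis using st by (auto simp: pq)
  next
    case False
    then show ?thesis using st by (auto simp: pq sb_add_class intro: PT.sum)
  qed
qed

lemma monomial_mult_polynomials:
  assumes "m \<in> monomials X" "q \<in> polynomials X"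
  shows "sb_mult m q \<in> polynomials X"
proof -
  obtain s t where st: "s \<in> MT X" "t \<in> PT X" and mq: "m = [s]\<^sub>A\<^sub>C" "q = [t]\<^sub>A\<^sub>C"
    using assms by (auto simp: polynomials_def monomials_def)
  show ?thesis
  proof (cases "t = Hat0 \<or> t = Hat1")
    case True
    with st MT_not_unit[OF st(1)] show ?thesis
      by (auto simp: mq sb_mult_def intro: PT.intros)
  next
    case False
    with st MT_not_unit[OF st(1)] show ?thesis
      by (auto simp: mq sb_mult_class intro: PT.product)
  qed
qed

lemma sb_sum_polynomials:
  assumes "set ps \<subseteq> polynomials X"
  shows "sb_sum ps \<in> polynomials X"
  using assms by (induction ps) (auto intro: sb_add_polynomials)

text \<open>
  In a product polynomial term, the monomials met before the first sum are collected by
  associativity.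
\<close>

lemma PT_cases:
  assumes "t \<in> PT X" "t \<noteq> Hat0" "t \<noteq> Hat1"
  shows "[t]\<^sub>A\<^sub>C \<in> monomials X \<or> [t]\<^sub>A\<^sub>C \<in> sum_polynomials X \<or>
    (\<exists>m\<in>MT X. \<exists>u. u \<noteq> Hat0 \<and> u \<noteq> Hat1 \<and> [u]\<^sub>A\<^sub>C \<in> sum_polynomials X \<and> [t]\<^sub>A\<^sub>C = [m \<^bold>* u]\<^sub>A\<^sub>C)"
  using assms
proof (induction rule: PT.induct)
  case (monomial t)
  then show ?case by (auto simp: monomials_def)
next
  case (sum s t)
  then show ?case by (auto simp: sum_polynomials_def)
next
  case (product s t)
  from product.IH[OF product.hyps(3,4)] consider
      (mono) "[t]\<^sub>A\<^sub>C \<in> monomials X" | (sum) "[t]\<^sub>A\<^sub>C \<in> sum_polynomials X"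
    | (prod) m u where "m \<in> MT X" "u \<noteq> Hat0" "u \<noteq> Hat1" "[u]\<^sub>A\<^sub>C \<in> sum_polynomials X" "[t]\<^sub>A\<^sub>C = [m \<^bold>* u]\<^sub>A\<^sub>C"
    by blast
  then show ?case
  proof cases
    case mono
    then obtain t' where "t' \<in> MT X" "t =\<^sub>A\<^sub>C t'"
      by (auto simp: monomials_def ac_class_eq_iff)
    then have "s \<^bold>* t' \<in> MT X" "[s \<^bold>* t]\<^sub>A\<^sub>C = [s \<^bold>* t']\<^sub>A\<^sub>C"
      using product.hyps(1) by (auto simp: ac_class_eq_iff intro: MT.intros ac_eq_times ac_eq_refl)
    then show ?thesis by (auto simp: monomials_def)
  next
    case sum
    with product.hyps show ?thesis by blast
  next
    case prod
    then have "s \<^bold>* t =\<^sub>A\<^sub>C s \<^bold>* (m \<^bold>* u)"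
      by (auto simp: ac_class_eq_iff intro: ac_eq_times ac_eq_refl)
    also have "s \<^bold>* (m \<^bold>* u) =\<^sub>A\<^sub>C (s \<^bold>* m) \<^bold>* u"
      by (intro ac_step_imp_ac_eq times_assoc)
    finally (ac_eq_trans) have "[s \<^bold>* t]\<^sub>A\<^sub>C = [(s \<^bold>* m) \<^bold>* u]\<^sub>A\<^sub>C"
      by (simp add: ac_class_eq_iff)
    moreover have "s \<^bold>* m \<in> MT X"
      using product.hyps(1) prod(1) by (intro MT.intros)
    ultimately show ?thesis using prod(2,3,4) by blast
  qed
qed simp_all

text \<open>
  The case distinction in the definition of \<open>mult_rd\<close> is exhaustive on polynomials.
\<close>

lemma polynomial_cases:
  assumes "q \<in> polynomials X" "q \<noteq> sb_zero" "q \<noteq> sb_one"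
    "q \<notin> monomials X" "q \<notin> sum_polynomials X"
  shows "\<exists>m\<in>monomials X. \<exists>q'\<in>sum_polynomials X. q = sb_mult m q'"
proof -
  obtain t where t: "t \<in> PT X" "q = [t]\<^sub>A\<^sub>C"
    using assms(1) by (auto simp: polynomials_def)
  with assms obtain m u where mu: "m \<in> MT X" "u \<noteq> Hat0" "u \<noteq> Hat1"
      "[u]\<^sub>A\<^sub>C \<in> sum_polynomials X" "q = [m \<^bold>* u]\<^sub>A\<^sub>C"
    using PT_cases[of t X] by auto
  with mu MT_not_unit[OF mu(1)] show ?thesis
    by (intro bexI[of _ "[m]\<^sub>A\<^sub>C"] bexI[of _ "[u]\<^sub>A\<^sub>C"]) (auto simp: sb_mult_class monomials_def)
qed

lemma mult_rd_zero [simp]: "mult_rd X sb_zero r = sb_zero" "mult_rd X q sb_zero = sb_zero"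
  by (simp_all add: mult_rd.simps)

lemma mult_rd_one [simp]: "mult_rd X sb_one r = r" "mult_rd X q sb_one = q"
  by (simp_all add: mult_rd.simps)

lemma sb_mult_unit_simps [simp]:
  "sb_mult sb_zero q = sb_zero" "sb_mult p sb_zero = sb_zero"
  "sb_mult sb_one q = q" "sb_mult p sb_one = p"
  by (auto simp: sb_mult_def)

lemma monomial_mult_rd:
  assumes "m \<in> monomials X"
  shows "mult_rd X m r = sb_mult m r"
  using assms by (simp add: mult_rd.simps[of X m r])

context rd_strong_bimonoid
begin

lemma term_val_closed:
  "f \<in> X \<rightarrow> carrier R \<Longrightarrow> t \<in> terms X \<Longrightarrow> term_val R f t \<in> carrier R"
  by (induction t) auto

lemma term_val_ac_step:
  assumes "f \<in> X \<rightarrow> carrier R"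
  shows "ac_step s t \<Longrightarrow> s \<in> terms X \<Longrightarrow> term_val R f s = term_val R f t"
proof (induction rule: ac_step.induct)
  case (plus_assoc a b c)
  then show ?case using assms by (simp add: term_val_closed a_assoc)
next
  case (plus_comm a b)
  then show ?case using assms by (simp add: term_val_closed a_comm)
next
  case (times_assoc a b c)
  then show ?case using assms by (simp add: term_val_closed m_assoc)
qed simp_all

text \<open>
  The invariance of \<open>term_val\<close> under \<open>ac_step\<close> holds for terms over \<open>X\<close> only; the function \<open>g\<close>
  extends it to an invariant of all terms.
\<close>

lemma class_val_class:
  assumes f: "f \<in> X \<rightarrow> carrier R" and "t \<in> terms X"
  shows "class_val R f [t]\<^sub>A\<^sub>C = term_val R f t"
proof -
  define g where "g u = (if u \<in> terms X then term_val R f u else undefined)" for u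
  have "g u = g v" if "ac_step u v" for u v
    using term_val_ac_step[OF f that] ac_step_tvars[OF that] by (auto simp: g_def terms_def)
  then have g_eq: "g u = g t" if "t =\<^sub>A\<^sub>C u" for u
    using ac_eq_invariant[OF that, of g] by simp
  have in_terms: "u \<in> terms X" if "t =\<^sub>A\<^sub>C u" for u
  proof -
    have "tvars t = tvars u"
      using that ac_step_tvars by (rule ac_eq_invariant)
    with assms(2) show ?thesis by (simp add: terms_def)
  qed
  have "term_val R f u = term_val R f t" if "t =\<^sub>A\<^sub>C u" for u
    using g_eq[OF that] in_terms[OF that] assms(2) by (simp add: g_def)
  then have "term_val R f ` [t]\<^sub>A\<^sub>C \<subseteq> {term_val R f t}"
    by (auto simp: ac_class_def)
  moreover have "t \<in> [t]\<^sub>A\<^sub>C"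
    by (simp add: ac_class_def ac_eq_refl)
  ultimately have "term_val R f ` [t]\<^sub>A\<^sub>C = {term_val R f t}"
    by blast
  then show ?thesis by (simp add: class_val_def)
qed

context
  fixes f :: "'x \<Rightarrow> 'a" and X :: "'x set"
  assumes f: "f \<in> X \<rightarrow> carrier R"
begin

lemma class_val_closed: "p \<in> polynomials X \<Longrightarrow> class_val R f p \<in> carrier R"
  by (auto simp: polynomials_def class_val_class[OF f] PT_terms intro!: term_val_closed[OF f])

lemma class_val_zero: "class_val R f sb_zero = \<zero>"
  and class_val_one: "class_val R f sb_one = \<one>"
  and class_val_Var: "x \<in> X \<Longrightarrow> class_val R f [Var x]\<^sub>A\<^sub>C = f x"
  by (simp_all add: class_val_class[OF f])

lemma class_val_add:
  assumes "p \<in> polynomials X" "q \<in> polynomials X"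
  shows "class_val R f (sb_add p q) = class_val R f p \<oplus> class_val R f q"
proof -
  obtain s t where st: "s \<in> PT X" "t \<in> PT X" and pq: "p = [s]\<^sub>A\<^sub>C" "q = [t]\<^sub>A\<^sub>C"
    using assms by (auto simp: polynomials_def)
  show ?thesis
  proof (cases "s = Hat0 \<or> t = Hat0")
    case True
    then show ?thesis using assms class_val_closed by (auto simp: pq class_val_zero)
  next
    case False
    then show ?thesis using st
      by (simp add: pq sb_add_class class_val_class[OF f] PT_terms)
  qed
qed

lemma class_val_monomial_mult:
  assumes "m \<in> monomials X" "q \<in> polynomials X"
  shows "class_val R f (sb_mult m q) = class_val R f m \<otimes> class_val R f q"
proof -
  obtain s t where st: "s \<in> MT X" "t \<in> PT X" and mq: "m = [s]\<^sub>A\<^sub>C" "q = [t]\<^sub>A\<^sub>C"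
    using assms by (auto simp: polynomials_def monomials_def)
  have m: "class_val R f m \<in> carrier R"
    using assms(1) monomials_subset_polynomials class_val_closed by blast
  show ?thesis
  proof (cases "t = Hat0 \<or> t = Hat1")
    case True
    with m show ?thesis by (auto simp: mq class_val_zero class_val_one mult_zero)
  next
    case False
    with st MT_not_unit[OF st(1)] show ?thesis
      by (simp add: mq sb_mult_class class_val_class[OF f] PT_terms PT.monomial)
  qed
qed

text \<open>
  Every branch of the recursion for \<open>mult_rd\<close> is an instance of a law of right-distributive
  strong bimonoids: right distributivity for a sum, associativity for a monomial times a sum,
  the laws for \<open>0\<close> and \<open>1\<close> in the trivial cases. The decompositions chosen in the definition
  enter only through the fact that they represent \<open>q\<close>, so the value of the product does not
  depend on the choice.
\<close>

lemma mult_rd_closed_and_class_val: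
  assumes "q \<in> polynomials X" "r \<in> polynomials X"
  shows "mult_rd X q r \<in> polynomials X \<and>
    class_val R f (mult_rd X q r) = class_val R f q \<otimes> class_val R f r"
  using assms(1)
proof (induction "class_size q" arbitrary: q rule: less_induct)
  case less
  note [simp] = class_val_zero class_val_one
  have vq: "class_val R f q \<in> carrier R" and vr: "class_val R f r \<in> carrier R"
    using less.prems assms by (auto intro: class_val_closed)
  consider (trivial) "q = sb_zero \<or> q = sb_one \<or> r = sb_zero \<or> r = sb_one"
    | (mono) "q \<in> monomials X"
    | (sum) "q \<noteq> sb_zero" "q \<noteq> sb_one" "r \<noteq> sb_zero" "r \<noteq> sb_one"
        "q \<notin> monomials X" "q \<in> sum_polynomials X"
    | (prod) "q \<noteq> sb_zero" "q \<noteq> sb_one" "r \<noteq> sb_zero" "r \<noteq> sb_one"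
        "q \<notin> monomials X" "q \<notin> sum_polynomials X"
        "\<exists>m\<in>monomials X. \<exists>q'\<in>sum_polynomials X. q = sb_mult m q'"
    using polynomial_cases[OF less.prems] by blast
  then show ?case
  proof cases
    case trivial
    then show ?thesis using less.prems assms vq vr by (auto simp: zero_mult mult_zero)
  next
    case mono
    then show ?thesis using assms(2)
      by (simp add: monomial_mult_rd monomial_mult_polynomials class_val_monomial_mult)
  next
    case sum
    let ?ps = "sum_decomp X q"
    have poly: "set ?ps \<subseteq> polynomials X"
      using sum_decomp_props(2)[OF sum(6)] product_polynomials_subset_polynomials
        gens_subset_monomials monomials_subset_polynomials by fastforce
    have IH: "mult_rd X p r \<in> polynomials X"
      "class_val R f (mult_rd X p r) = class_val R f p \<otimes> class_val R f r" if "p \<in> set ?ps" for p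
      using less.hyps[of p] sum_decomp_size[OF sum(6) that] that poly by auto
    have "sb_sum (map (\<lambda>p. mult_rd X p r) ps) \<in> polynomials X \<and>
        class_val R f (sb_sum (map (\<lambda>p. mult_rd X p r) ps)) =
        class_val R f (sb_sum ps) \<otimes> class_val R f r" if "set ps \<subseteq> set ?ps" for ps
      using that
    proof (induction ps)
      case Nil
      then show ?case using vr by (simp add: zero_mult)
    next
      case (Cons p ps)
      moreover have "sb_sum ps \<in> polynomials X" "p \<in> polynomials X"
        using Cons.prems poly by (auto intro: sb_sum_polynomials)
      ultimately show ?case
        using IH[of p] vr
        by (simp add: sb_add_polynomials class_val_add class_val_closed right_distr)
    qed
    from this[of ?ps] show ?thesis
      using sum by (simp add: mult_rd.simps[of X q r] sum_decomp_props(3))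
  next
    case prod
    note pd = prod_decomp_props[OF prod(7)]
    let ?m = "fst (prod_decomp X q)" and ?q = "snd (prod_decomp X q)"
    have q: "?q \<in> polynomials X"
      using pd(2) sum_polynomials_subset_polynomials by blast
    have m: "?m \<in> polynomials X"
      using pd(1) monomials_subset_polynomials by blast
    have IH: "mult_rd X ?q r \<in> polynomials X"
      "class_val R f (mult_rd X ?q r) = class_val R f ?q \<otimes> class_val R f r"
      using less.hyps[OF prod_decomp_size[OF prod(7)] q] by auto
    have "class_val R f q = class_val R f ?m \<otimes> class_val R f ?q"
      using class_val_monomial_mult[OF pd(1) q] pd(3) by simp
    moreover have "mult_rd X q r = sb_mult ?m (mult_rd X ?q r)"
      using prod by (simp add: mult_rd.simps[of X q r])
    ultimately show ?thesis
      using pd(1) IH q m vr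
      by (simp add: monomial_mult_polynomials class_val_monomial_mult class_val_closed m_assoc)
  qed
qed

lemmas mult_rd_closed = mult_rd_closed_and_class_val[THEN conjunct1]
  and class_val_mult_rd = mult_rd_closed_and_class_val[THEN conjunct2]

end

end

section \<open>From normal forms back to classes\<close>

lemma sb_add_member:
  "p \<noteq> sb_zero \<Longrightarrow> q \<noteq> sb_zero \<Longrightarrow> u \<in> sb_add p q \<longleftrightarrow> (\<exists>s\<in>p. \<exists>t\<in>q. s \<^bold>+ t =\<^sub>A\<^sub>C u)"
  by (simp add: sb_add_def ac_class_def)

lemma sb_mult_member:
  "p \<noteq> sb_zero \<Longrightarrow> q \<noteq> sb_zero \<Longrightarrow> p \<noteq> sb_one \<Longrightarrow> q \<noteq> sb_one \<Longrightarrow>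
    u \<in> sb_mult p q \<longleftrightarrow> (\<exists>s\<in>p. \<exists>t\<in>q. s \<^bold>* t =\<^sub>A\<^sub>C u)"
  by (simp add: sb_mult_def ac_class_def)

lemma not_ac_eq_constant [simp]:
  "\<not> s \<^bold>+ t =\<^sub>A\<^sub>C Hat0" "\<not> s \<^bold>* t =\<^sub>A\<^sub>C Hat0" "\<not> s \<^bold>* t =\<^sub>A\<^sub>C Hat1"
  by (simp_all flip: ac_class_eq_iff)

lemma constant_in_own_class [simp]: "Hat0 \<in> sb_zero" "Hat1 \<in> sb_one"
  by (simp_all add: ac_class_def ac_eq_refl)

lemma sb_add_nonzero: "p \<noteq> sb_zero \<Longrightarrow> q \<noteq> sb_zero \<Longrightarrow> sb_add p q \<noteq> sb_zero"
  by (metis sb_add_member constant_in_own_class(1) not_ac_eq_constant(1))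

lemma sb_mult_nonunit:
  assumes "p \<noteq> sb_zero" "q \<noteq> sb_zero" "p \<noteq> sb_one" "q \<noteq> sb_one"
  shows "sb_mult p q \<noteq> sb_zero" "sb_mult p q \<noteq> sb_one"
  using assms by (metis sb_mult_member constant_in_own_class not_ac_eq_constant(2,3))+

text \<open>
  The operations on classes are associative, and addition is commutative, on arbitrary sets of
  terms. Sums over multisets can therefore be formed without carrying a carrier set along.
\<close>

lemma sb_add_commute: "sb_add p q = sb_add q p"
proof (cases "p = sb_zero \<or> q = sb_zero")
  case False
  have swap: "s \<^bold>+ t =\<^sub>A\<^sub>C u \<longleftrightarrow> t \<^bold>+ s =\<^sub>A\<^sub>C u" for s t u :: "'a trm"
    by (meson ac_eq_trans ac_step_imp_ac_eq plus_comm)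
  show ?thesis
  proof (rule Set.set_eqI)
    fix u
    show "u \<in> sb_add p q \<longleftrightarrow> u \<in> sb_add q p"
      using False swap[of _ _ u] by (simp add: sb_add_member) blast
  qed
qed auto

lemma sb_add_assoc: "sb_add (sb_add p q) r = sb_add p (sb_add q r)"
proof (cases "p = sb_zero \<or> q = sb_zero \<or> r = sb_zero")
  case False
  show ?thesis
  proof (rule Set.set_eqI)
    fix u
    \<comment> \<open>The intermediate term \<open>s\<close> ranges over the class of \<open>a \<^bold>+ b\<close> and can be replaced by it.\<close>
    have left: "(\<exists>s. a \<^bold>+ b =\<^sub>A\<^sub>C s \<and> (\<exists>c\<in>r. s \<^bold>+ c =\<^sub>A\<^sub>C u)) \<longleftrightarrow> (\<exists>c\<in>r. (a \<^bold>+ b) \<^bold>+ c =\<^sub>A\<^sub>C u)"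
      for a b
      by (meson ac_eq_plus ac_eq_refl ac_eq_sym ac_eq_trans)
    have right: "(\<exists>s. b \<^bold>+ c =\<^sub>A\<^sub>C s \<and> a \<^bold>+ s =\<^sub>A\<^sub>C u) \<longleftrightarrow> a \<^bold>+ (b \<^bold>+ c) =\<^sub>A\<^sub>C u" for a b c
      by (meson ac_eq_plus ac_eq_refl ac_eq_sym ac_eq_trans)
    have assoc: "(a \<^bold>+ b) \<^bold>+ c =\<^sub>A\<^sub>C u \<longleftrightarrow> a \<^bold>+ (b \<^bold>+ c) =\<^sub>A\<^sub>C u" for a b c
      by (meson ac_eq_sym ac_eq_trans ac_step_imp_ac_eq plus_assoc)
    have "u \<in> sb_add (sb_add p q) r \<longleftrightarrow>
        (\<exists>a\<in>p. \<exists>b\<in>q. \<exists>s. a \<^bold>+ b =\<^sub>A\<^sub>C s \<and> (\<exists>c\<in>r. s \<^bold>+ c =\<^sub>A\<^sub>C u))"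
      using False by (simp add: sb_add_member sb_add_nonzero) (simp add: Bex_def sb_add_member, blast)
    moreover have "u \<in> sb_add p (sb_add q r) \<longleftrightarrow>
        (\<exists>a\<in>p. \<exists>b\<in>q. \<exists>c\<in>r. \<exists>s. b \<^bold>+ c =\<^sub>A\<^sub>C s \<and> a \<^bold>+ s =\<^sub>A\<^sub>C u)"
      using False by (simp add: sb_add_member sb_add_nonzero) (simp add: Bex_def sb_add_member, blast)
    ultimately show "u \<in> sb_add (sb_add p q) r \<longleftrightarrow> u \<in> sb_add p (sb_add q r)"
      by (simp only: left right assoc)
  qed
qed auto

lemma sb_mult_assoc: "sb_mult (sb_mult p q) r = sb_mult p (sb_mult q r)"
proof (cases "p \<in> {sb_zero, sb_one} \<or> q \<in> {sb_zero, sb_one} \<or> r \<in> {sb_zero, sb_one}")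
  case False
  show ?thesis
  proof (rule Set.set_eqI)
    fix u
    have left: "(\<exists>s. a \<^bold>* b =\<^sub>A\<^sub>C s \<and> (\<exists>c\<in>r. s \<^bold>* c =\<^sub>A\<^sub>C u)) \<longleftrightarrow> (\<exists>c\<in>r. (a \<^bold>* b) \<^bold>* c =\<^sub>A\<^sub>C u)"
      for a b
      by (meson ac_eq_times ac_eq_refl ac_eq_sym ac_eq_trans)
    have right: "(\<exists>s. b \<^bold>* c =\<^sub>A\<^sub>C s \<and> a \<^bold>* s =\<^sub>A\<^sub>C u) \<longleftrightarrow> a \<^bold>* (b \<^bold>* c) =\<^sub>A\<^sub>C u" for a b c
      by (meson ac_eq_times ac_eq_refl ac_eq_sym ac_eq_trans)
    have assoc: "(a \<^bold>* b) \<^bold>* c =\<^sub>A\<^sub>C u \<longleftrightarrow> a \<^bold>* (b \<^bold>* c) =\<^sub>A\<^sub>C u" for a b c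
      by (meson ac_eq_sym ac_eq_trans ac_step_imp_ac_eq times_assoc)
    have "u \<in> sb_mult (sb_mult p q) r \<longleftrightarrow>
        (\<exists>a\<in>p. \<exists>b\<in>q. \<exists>s. a \<^bold>* b =\<^sub>A\<^sub>C s \<and> (\<exists>c\<in>r. s \<^bold>* c =\<^sub>A\<^sub>C u))"
      using False by (simp add: sb_mult_member sb_mult_nonunit) (simp add: Bex_def sb_mult_member, blast)
    moreover have "u \<in> sb_mult p (sb_mult q r) \<longleftrightarrow>
        (\<exists>a\<in>p. \<exists>b\<in>q. \<exists>c\<in>r. \<exists>s. b \<^bold>* c =\<^sub>A\<^sub>C s \<and> a \<^bold>* s =\<^sub>A\<^sub>C u)"
      using False by (simp add: sb_mult_member sb_mult_nonunit) (simp add: Bex_def sb_mult_member, blast)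
    ultimately show "u \<in> sb_mult (sb_mult p q) r \<longleftrightarrow> u \<in> sb_mult p (sb_mult q r)"
      by (simp only: left right assoc)
  qed
qed auto

definition class_sum :: "'x trm set multiset \<Rightarrow> 'x trm set" where
  "class_sum = fold_mset sb_add sb_zero"

interpretation sb_add: comp_fun_commute "sb_add :: 'x trm set \<Rightarrow> _"
proof
  fix p q :: "'x trm set"
  have "sb_add p (sb_add q r) = sb_add q (sb_add p r)" for r
    by (metis sb_add_assoc sb_add_commute)
  then show "sb_add p \<circ> sb_add q = sb_add q \<circ> sb_add p"
    by (simp add: fun_eq_iff)
qed

lemma class_sum_simps [simp]:
  "class_sum {#} = sb_zero"
  "class_sum (add_mset p M) = sb_add p (class_sum M)"
  by (simp_all add: class_sum_def)

text \<open>
  The inverse of the normal form: the class of the term that an atom stands for.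
\<close>

primrec atom_class :: "'x atom \<Rightarrow> 'x trm set" where
  "atom_class Unit = sb_one"
| "atom_class (Lead x q) = sb_mult [Var x]\<^sub>A\<^sub>C (class_sum (image_mset atom_class q))"

definition nf_class :: "'x atom multiset \<Rightarrow> 'x trm set" where
  "nf_class q = class_sum (image_mset atom_class q)"

lemma nf_class_simps [simp]:
  "nf_class {#} = sb_zero"
  "nf_class (add_mset i q) = sb_add (atom_class i) (nf_class q)"
  by (simp_all add: nf_class_def)

lemma nf_class_plus: "nf_class (p + q) = sb_add (nf_class p) (nf_class q)"
  by (induction p) (simp_all add: sb_add_assoc)

lemma atom_class_Lead: "atom_class (Lead x q) = sb_mult [Var x]\<^sub>A\<^sub>C (nf_class q)"
  by (simp add: nf_class_def)

declare atom_class.simps(2) [simp del]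

lemma nf_class_mset: "nf_class (mset is) = sb_sum (map atom_class is)"
  by (induction "is") simp_all

definition term_nf :: "'x trm \<Rightarrow> 'x atom multiset" where
  "term_nf = term_val nf_ring (\<lambda>x. {#Lead x {#Unit#}#})"

definition nf :: "'x trm set \<Rightarrow> 'x atom multiset" where
  "nf = class_val nf_ring (\<lambda>x. {#Lead x {#Unit#}#})"

lemma term_nf_simps [simp]:
  "term_nf (Var x) = {#Lead x {#Unit#}#}"
  "term_nf Hat0 = {#}"
  "term_nf Hat1 = {#Unit#}"
  "term_nf (s \<^bold>+ t) = term_nf s + term_nf t"
  "term_nf (s \<^bold>* t) = nf_mult (term_nf s) (term_nf t)"
  by (simp_all add: term_nf_def nf_ring_def)

lemma generator_in_nf_ring: "(\<lambda>x. {#Lead x {#Unit#}#}) \<in> X \<rightarrow> carrier nf_ring"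
  by (simp add: nf_ring_def)

lemma nf_ring_simps [simp]:
  "carrier nf_ring = UNIV" "mult nf_ring = nf_mult" "one nf_ring = {#Unit#}"
  "zero nf_ring = {#}" "add nf_ring = (+)"
  by (simp_all add: nf_ring_def)

lemma nf_term: "nf [t]\<^sub>A\<^sub>C = term_nf t"
  using rd_strong_bimonoid.class_val_class[OF rd_strong_bimonoid_nf_ring generator_in_nf_ring,
      of t "tvars t"]
  by (simp add: nf_def term_nf_def terms_def)

lemma nf_add:
  "p \<in> polynomials X \<Longrightarrow> q \<in> polynomials X \<Longrightarrow> nf (sb_add p q) = nf p + nf q"
  using rd_strong_bimonoid.class_val_add[OF rd_strong_bimonoid_nf_ring generator_in_nf_ring]
  by (fastforce simp: nf_def)

lemma mult_rd_polynomials: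
  "p \<in> polynomials X \<Longrightarrow> q \<in> polynomials X \<Longrightarrow> mult_rd X p q \<in> polynomials X"
  by (rule rd_strong_bimonoid.mult_rd_closed[OF rd_strong_bimonoid_nf_ring generator_in_nf_ring])

lemma nf_mult_rd:
  "p \<in> polynomials X \<Longrightarrow> q \<in> polynomials X \<Longrightarrow> nf (mult_rd X p q) = nf_mult (nf p) (nf q)"
  using rd_strong_bimonoid.class_val_mult_rd[OF rd_strong_bimonoid_nf_ring generator_in_nf_ring]
  by (fastforce simp: nf_def)

lemma nf_mult_generator: "p \<noteq> {#} \<Longrightarrow> nf_mult {#Lead x {#Unit#}#} p = {#Lead x p#}"
  by (simp add: nf_mult_def)

lemma nf_mult_nonempty: "p \<noteq> {#} \<Longrightarrow> q \<noteq> {#} \<Longrightarrow> nf_mult p q \<noteq> {#}"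
  by (simp add: nf_mult_def nf_subst_empty_iff)

lemma term_nf_monomial: "s \<in> MT X \<Longrightarrow> \<exists>x q. term_nf s = {#Lead x q#}"
proof (induction rule: MT.induct)
  case (2 s t)
  then show ?case by (auto simp: nf_mult_def)
qed simp

text \<open>
  Left multiplication by a generator \<open>x\<close> turns a nonzero \<open>p\<close> into the single atom \<open>Lead x p\<close>,
  whose class is \<open>x\<close> times the class of \<open>p\<close> by definition. Longer monomials multiply one
  generator at a time.
\<close>

lemma nf_class_monomial_mult:
  "s \<in> MT X \<Longrightarrow> p \<noteq> {#} \<Longrightarrow> nf_class (nf_mult (term_nf s) p) = sb_mult [s]\<^sub>A\<^sub>C (nf_class p)"
proof (induction arbitrary: p rule: MT.induct)
  case (1 x)
  then show ?case by (simp add: nf_mult_generator atom_class_Lead)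
next
  case (2 s t)
  have "term_nf t \<noteq> {#}"
    using term_nf_monomial[OF 2(2)] by auto
  with 2 MT_not_unit[OF 2(1)] MT_not_unit[OF 2(2)] show ?case
    by (simp add: nf_mult_assoc nf_mult_nonempty sb_mult_assoc flip: sb_mult_class)
qed

lemma nf_class_term_nf: "t \<in> PT X \<Longrightarrow> nf_class (term_nf t) = [t]\<^sub>A\<^sub>C"
proof (induction rule: PT.induct)
  case (monomial t)
  then show ?case using nf_class_monomial_mult[of t X "{#Unit#}"] by simp
next
  case (sum s t)
  then show ?case by (simp add: nf_class_plus sb_add_class)
next
  case (product s t)
  then have "term_nf t \<noteq> {#}"
    by (metis class_eq_zero_iff nf_class_simps(1))
  with product MT_not_unit[OF product(1)] show ?case
    by (simp add: nf_class_monomial_mult sb_mult_class)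
qed simp_all

text \<open>
  The normal form determines the polynomial; this is the injectivity of \<open>nf\<close> on which both parts
  of the theorem rest.
\<close>

lemma nf_class_nf: "p \<in> polynomials X \<Longrightarrow> nf_class (nf p) = p"
  by (auto simp: polynomials_def nf_term nf_class_term_nf)

lemma inj_on_nf: "inj_on nf (polynomials X)"
  by (metis inj_on_inverseI nf_class_nf)

section \<open>The free right-distributive strong bimonoid\<close>

text \<open>
  All axioms are equations, so they are inherited along an injective homomorphism.
\<close>

lemma rd_strong_bimonoid_embedding:
  fixes R :: "('a, 'm) ring_scheme" and S :: "('b, 'n) ring_scheme"
  assumes "rd_strong_bimonoid S" and h: "h \<in> sb_hom R S" and inj: "inj_on h (carrier R)"
    and closed: "\<zero>\<^bsub>R\<^esub> \<in> carrier R" "\<one>\<^bsub>R\<^esub> \<in> carrier R"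
      "\<And>a b. a \<in> carrier R \<Longrightarrow> b \<in> carrier R \<Longrightarrow> a \<oplus>\<^bsub>R\<^esub> b \<in> carrier R"
      "\<And>a b. a \<in> carrier R \<Longrightarrow> b \<in> carrier R \<Longrightarrow> a \<otimes>\<^bsub>R\<^esub> b \<in> carrier R"
  shows "rd_strong_bimonoid R"
proof -
  interpret S: rd_strong_bimonoid S by fact
  have hom: "h a \<in> carrier S" "h (a \<oplus>\<^bsub>R\<^esub> b) = h a \<oplus>\<^bsub>S\<^esub> h b" "h (a \<otimes>\<^bsub>R\<^esub> b) = h a \<otimes>\<^bsub>S\<^esub> h b"
    if "a \<in> carrier R" "b \<in> carrier R" for a b
    using h that by (auto simp: sb_hom_def ring_hom_def)
  have hom0: "h \<zero>\<^bsub>R\<^esub> = \<zero>\<^bsub>S\<^esub>" "h \<one>\<^bsub>R\<^esub> = \<one>\<^bsub>S\<^esub>"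
    using h by (auto simp: sb_hom_def ring_hom_def)
  show ?thesis
    by unfold_locales
      (auto intro!: inj_onD[OF inj] simp: closed hom hom0 S.a_ac S.m_assoc
        S.zero_mult S.mult_zero S.right_distr)
qed

lemma idem_rd_strong_bimonoid_embedding:
  fixes R :: "('a, 'm) ring_scheme" and S :: "('b, 'n) ring_scheme"
  assumes "idem_rd_strong_bimonoid S" and h: "h \<in> sb_hom R S" and inj: "inj_on h (carrier R)"
    and closed: "\<zero>\<^bsub>R\<^esub> \<in> carrier R" "\<one>\<^bsub>R\<^esub> \<in> carrier R"
      "\<And>a b. a \<in> carrier R \<Longrightarrow> b \<in> carrier R \<Longrightarrow> a \<oplus>\<^bsub>R\<^esub> b \<in> carrier R"
      "\<And>a b. a \<in> carrier R \<Longrightarrow> b \<in> carrier R \<Longrightarrow> a \<otimes>\<^bsub>R\<^esub> b \<in> carrier R"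
  shows "idem_rd_strong_bimonoid R"
proof -
  interpret S: idem_rd_strong_bimonoid S by fact
  interpret R: rd_strong_bimonoid R
    using S.rd_strong_bimonoid_axioms assms(2-) by (rule rd_strong_bimonoid_embedding)
  show ?thesis
  proof
    fix b assume "b \<in> carrier R"
    with h show "b \<oplus>\<^bsub>R\<^esub> b = b"
      by (intro inj_onD[OF inj]) (auto simp: sb_hom_def ring_hom_def Pi_iff S.add_idem)
  qed
qed

theorem rd_strong_bimonoid_N_rd: "rd_strong_bimonoid (N_rd X)"
proof (rule rd_strong_bimonoid_embedding[OF rd_strong_bimonoid_nf_ring])
  show "nf \<in> sb_hom (N_rd X) nf_ring"
    by (auto simp: sb_hom_def ring_hom_def N_rd_def nf_add nf_mult_rd nf_term)
  show "inj_on nf (carrier (N_rd X))"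
    by (simp add: N_rd_def inj_on_nf)
qed (auto simp: N_rd_def intro: sb_add_polynomials mult_rd_polynomials)

text \<open>
  Monomials are products of generators. The other polynomials arise from them by sums and by
  products with a monomial on the left, where \<open>mult_rd\<close> agrees with \<open>sb_mult\<close>. The extension of
  \<open>f\<close> is evaluation.
\<close>

theorem freely_generated_N_rd:
  "freely_generated (rd_strong_bimonoid :: 'b ring \<Rightarrow> bool) (N_rd X) (gens X)"
proof -
  interpret rd_strong_bimonoid "N_rd X"
    by (rule rd_strong_bimonoid_N_rd)
  have gens: "gens X \<subseteq> carrier (N_rd X)"
    using gens_subset_monomials monomials_subset_polynomials by (fastforce simp: N_rd_def)
  have "p \<in> carrier (N_rd X)" if "p \<in> sb_generate (N_rd X) (gens X)" for p
    using that gens by induction auto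
  moreover have MT: "[s]\<^sub>A\<^sub>C \<in> sb_generate (N_rd X) (gens X)" if "s \<in> MT X" for s
    using that
  proof induction
    case (1 x)
    then show ?case by (auto simp: gens_def intro: sb_generate.base)
  next
    case (2 s t)
    then have "[s \<^bold>* t]\<^sub>A\<^sub>C = [s]\<^sub>A\<^sub>C \<otimes>\<^bsub>N_rd X\<^esub> [t]\<^sub>A\<^sub>C"
      using MT_not_unit[of s X] MT_not_unit[of t X]
      by (simp add: N_rd_def monomial_mult_rd monomials_def sb_mult_class)
    with 2 show ?case by (simp add: sb_generate.mult)
  qed
  moreover have "[t]\<^sub>A\<^sub>C \<in> sb_generate (N_rd X) (gens X)" if "t \<in> PT X" for t
    using that
  proof induction
    case zero
    then show ?case using sb_generate.zero[of "N_rd X"] by (simp add: N_rd_def)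
  next
    case one
    then show ?case using sb_generate.one[of "N_rd X"] by (simp add: N_rd_def)
  next
    case (sum s t)
    then have "[s \<^bold>+ t]\<^sub>A\<^sub>C = [s]\<^sub>A\<^sub>C \<oplus>\<^bsub>N_rd X\<^esub> [t]\<^sub>A\<^sub>C"
      by (simp add: N_rd_def sb_add_class)
    with sum show ?case by (simp add: sb_generate.add)
  next
    case (product s t)
    then have "[s \<^bold>* t]\<^sub>A\<^sub>C = [s]\<^sub>A\<^sub>C \<otimes>\<^bsub>N_rd X\<^esub> [t]\<^sub>A\<^sub>C"
      using MT_not_unit[of s X]
      by (simp add: N_rd_def monomial_mult_rd monomials_def sb_mult_class)
    with product MT show ?case by (simp add: sb_generate.mult)
  qed (rule MT)
  ultimately have "sb_generate (N_rd X) (gens X) = carrier (N_rd X)"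
    by (auto simp: N_rd_def polynomials_def)
  moreover have "\<exists>h\<in>sb_hom (N_rd X) A. \<forall>y\<in>gens X. h y = f y"
    if "rd_strong_bimonoid A" "f \<in> gens X \<rightarrow> carrier A" for A :: "'b ring" and f
  proof -
    interpret A: rd_strong_bimonoid A by fact
    have g: "(\<lambda>x. f [Var x]\<^sub>A\<^sub>C) \<in> X \<rightarrow> carrier A"
      using that(2) by (auto simp: gens_def)
    have "class_val A (\<lambda>x. f [Var x]\<^sub>A\<^sub>C) \<in> sb_hom (N_rd X) A"
      using A.class_val_closed[OF g] A.class_val_add[OF g] A.class_val_mult_rd[OF g]
        A.class_val_zero[OF g] A.class_val_one[OF g]
      by (auto simp: sb_hom_def ring_hom_def N_rd_def)
    moreover have "\<forall>y\<in>gens X. class_val A (\<lambda>x. f [Var x]\<^sub>A\<^sub>C) y = f y"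
      using A.class_val_Var[OF g] by (auto simp: gens_def)
    ultimately show ?thesis by blast
  qed
  ultimately show ?thesis
    using gens by (simp add: freely_generated_def)
qed

section \<open>Id-reduced polynomials are those with reduced normal form\<close>

lemma summands_props:
  assumes "t \<in> PT X" "t \<noteq> Hat0" "u \<in> set (summands t)"
  shows "u \<in> PT X \<and> u \<noteq> Hat0 \<and> (\<forall>a b. u \<noteq> a \<^bold>+ b)"
  using assms
proof (induction rule: PT.induct)
  case (monomial t)
  then show ?case by (cases t rule: MT.cases) (auto intro: PT.monomial MT.intros)
next
  case (product s t)
  then show ?case by (auto intro: PT.product)
qed (auto intro: PT.intros)

lemma term_nf_summands: "term_nf t = sum_list (map term_nf (summands t))"
  by (induction t rule: summands.induct) simp_all

text \<open>
  The summands of a polynomial correspond to the atoms of its normal form, hence the sum-product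
  decomposition is determined up to order and AC-equality.
\<close>

lemma term_nf_non_sum:
  assumes "u \<in> PT X" "u \<noteq> Hat0" "\<forall>a b. u \<noteq> a \<^bold>+ b"
  shows "\<exists>i. term_nf u = {#i#}"
  using assms(1)
proof cases
  case (monomial)
  then show ?thesis using term_nf_monomial by blast
next
  case (product s t)
  then obtain x q where "term_nf s = {#Lead x q#}"
    using term_nf_monomial by blast
  moreover have "term_nf t \<noteq> {#}"
    using nf_class_term_nf product by (metis class_eq_zero_iff nf_class_simps(1))
  ultimately show ?thesis
    using product by (simp add: nf_mult_def)
qed (use assms in auto)

lemma distinct_classes_iff:
  "distinct (map ac_class ts) \<longleftrightarrow>
    (\<forall>i j. i < j \<and> j < length ts \<longrightarrow> \<not> ts ! i =\<^sub>A\<^sub>C ts ! j)"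
proof -
  have "(\<forall>i<length ts. \<forall>j<length ts. i \<noteq> j \<longrightarrow> [ts ! i]\<^sub>A\<^sub>C \<noteq> [ts ! j]\<^sub>A\<^sub>C) \<longleftrightarrow>
      (\<forall>i j. i < j \<and> j < length ts \<longrightarrow> [ts ! i]\<^sub>A\<^sub>C \<noteq> [ts ! j]\<^sub>A\<^sub>C)" (is "?L \<longleftrightarrow> ?R")
  proof
    assume R: ?R
    show ?L
    proof (intro allI impI)
      fix i j assume "i < length ts" "j < length ts" "i \<noteq> j"
      with R[rule_format, of i j] R[rule_format, of j i] show "[ts ! i]\<^sub>A\<^sub>C \<noteq> [ts ! j]\<^sub>A\<^sub>C"
        by (cases i j rule: linorder_cases) simp_all
    qed
  qed simp
  then show ?thesis
    by (simp add: distinct_conv_nth ac_class_eq_iff)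
qed

text \<open>
  For a sum term the atoms of the summands are different because summands with the same atom
  have the same normal form and so are AC-equal, contrary to the rule for sums in \<open>ST_id\<close>.
\<close>

lemma reduced_term_nf:
  assumes "t \<in> ST_id X" "t \<in> PT X"
  shows "reduced X (term_nf t)"
  using assms
proof (induction rule: ST_id.induct)
  case (monomial t)
  then show ?case
  proof (induction rule: MT.induct)
    case (2 s t)
    then show ?case by (simp add: reduced_nf_mult PT.monomial)
  qed (simp add: reduced_atom.Unit)
next
  case (sum s1 s2 ts)
  have ts: "u \<in> PT X" "u \<noteq> Hat0" "\<forall>a b. u \<noteq> a \<^bold>+ b" if "u \<in> set ts" for u
    using summands_props[OF sum.prems, of u] that sum.hyps(3) by simp_all
  have red: "reduced X (term_nf u)" if "u \<in> set ts" for u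
    using sum.IH ts that by blast
  have dist: "distinct (map ac_class ts)"
    unfolding distinct_classes_iff by (fact sum.hyps)
  have "reduced X (sum_list (map term_nf us))"
    if "set us \<subseteq> set ts" "distinct (map ac_class us)" for us
    using that
  proof (induction us)
    case (Cons u us)
    obtain i where i: "term_nf u = {#i#}"
      using term_nf_non_sum[of u X] ts[of u] Cons.prems by auto
    have "i \<notin># term_nf v" if v: "v \<in> set us" for v
    proof
      assume "i \<in># term_nf v"
      moreover obtain j where "term_nf v = {#j#}"
        using term_nf_non_sum[of v X] ts[of v] Cons.prems v by auto
      ultimately have "term_nf v = term_nf u"
        using i by simp
      then have "[v]\<^sub>A\<^sub>C = [u]\<^sub>A\<^sub>C"
        using nf_class_term_nf[OF ts(1)] Cons.prems(1) v by (metis list.set_intros subsetD)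
      with v have "[u]\<^sub>A\<^sub>C \<in> ac_class ` set us"
        by (metis imageI)
      with Cons.prems(2) show False by simp
    qed
    then have "i \<notin># sum_list (map term_nf us)"
      by (induction us) auto
    then show ?case
      using Cons red[of u] i by (simp add: reduced_add_mset)
  qed simp
  from this[of ts] dist show ?case
    using term_nf_summands[of "s1 \<^bold>+ s2"] sum.hyps(3) by simp
next
  case (product s t)
  from product.prems have st: "s \<in> PT X \<and> t \<in> PT X"
  proof cases
    case monomial
    then show ?thesis
      by (auto elim: MT.cases intro: PT.monomial)
  qed (auto intro: PT.monomial)
  with product show ?case by (simp add: reduced_nf_mult)
qed (simp_all add: reduced_atom.Unit)

lemma PT_id_with_summands:
  assumes "us \<noteq> []" "distinct (map ac_class us)"
    and "\<And>u. u \<in> set us \<Longrightarrow> u \<in> PT_id X \<and> u \<noteq> Hat0 \<and> (\<forall>a b. u \<noteq> a \<^bold>+ b)"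
  shows "\<exists>t\<in>PT_id X. t \<noteq> Hat0 \<and> summands t = us"
  using assms
proof (induction us rule: list_nonempty_induct)
  case (single u)
  then have "u \<in> PT_id X" "u \<noteq> Hat0" "summands u = [u]"
    by (auto, cases u) auto
  then show ?case by blast
next
  case (cons u us)
  then obtain t where t: "t \<in> PT_id X" "t \<noteq> Hat0" "summands t = us"
    by (auto simp del: map_map)
  have u: "u \<in> PT_id X" "u \<noteq> Hat0" "summands u = [u]"
    using cons.prems(2)[of u] by (auto, cases u) auto
  have "u \<^bold>+ t \<in> ST_id X"
  proof (rule ST_id.sum[OF _ _ refl])
    show "u \<in> ST X - {Hat0}" "t \<in> ST X - {Hat0}"
      using u t ST_id_ST by (auto simp: PT_id_def)
    show "\<forall>v\<in>set (summands (u \<^bold>+ t)). v \<in> ST_id X"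
      using u t cons.prems(2) by (auto simp: PT_id_def)
    have "distinct (map ac_class (summands (u \<^bold>+ t)))"
      using u t cons.prems(1) by simp
    then show "\<forall>i j. i < j \<and> j < length (summands (u \<^bold>+ t)) \<longrightarrow>
        \<not> summands (u \<^bold>+ t) ! i =\<^sub>A\<^sub>C summands (u \<^bold>+ t) ! j"
      unfolding distinct_classes_iff .
  qed
  then have "u \<^bold>+ t \<in> PT_id X"
    using u t by (auto simp: PT_id_def intro: PT.sum)
  then show ?case
    using u t by (intro bexI[of _ "u \<^bold>+ t"]) auto
qed

lemma distinct_if_reduced: "reduced X (mset xs) \<Longrightarrow> distinct xs"
  by (induction xs) (simp_all add: reduced_add_mset)

text \<open>
  Passing from normal forms back to terms, for a multiset whose atoms are known to have terms:
  terms representing the atoms of a reduced multiset are not AC-equal, as their normal forms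
  differ, so they may be added up to an id-reduced term.
\<close>

lemma PT_id_of_reduced_atoms:
  assumes "\<forall>i\<in>#q. \<exists>u\<in>PT_id X. u \<noteq> Hat0 \<and> (\<forall>a b. u \<noteq> a \<^bold>+ b) \<and> term_nf u = {#i#}"
    and "reduced X q"
  shows "\<exists>t\<in>PT_id X. term_nf t = q"
proof (cases "q = {#}")
  case True
  have "Hat0 \<in> PT_id X"
    by (auto simp: PT_id_def intro: PT.intros ST_id.intros)
  with True show ?thesis by (intro bexI[of _ Hat0]) simp_all
next
  case False
  from assms(1) obtain g where g:
    "\<And>i. i \<in># q \<Longrightarrow> g i \<in> PT_id X \<and> g i \<noteq> Hat0 \<and> (\<forall>a b. g i \<noteq> a \<^bold>+ b) \<and> term_nf (g i) = {#i#}"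
    by metis
  obtain xs where xs: "mset xs = q"
    using ex_mset by blast
  have inj: "i = j" if "i \<in># q" "j \<in># q" "[g i]\<^sub>A\<^sub>C = [g j]\<^sub>A\<^sub>C" for i j
  proof -
    have "term_nf (g i) = term_nf (g j)"
      using that(3) by (metis nf_term)
    then show ?thesis using g[OF that(1)] g[OF that(2)] by simp
  qed
  have "distinct xs"
    using assms(2) by (simp add: xs[symmetric] distinct_if_reduced)
  then have "distinct (map ac_class (map g xs))"
    using inj xs by (auto simp: distinct_map inj_on_def)
  moreover have "map g xs \<noteq> []"
    using False xs by auto
  moreover have "u \<in> PT_id X \<and> u \<noteq> Hat0 \<and> (\<forall>a b. u \<noteq> a \<^bold>+ b)" if "u \<in> set (map g xs)" for u
    using that g xs by auto
  ultimately obtain t where t: "t \<in> PT_id X" "summands t = map g xs"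
    using PT_id_with_summands[of "map g xs" X] by blast
  have "term_nf t = sum_list (map (\<lambda>i. term_nf (g i)) xs)"
    by (simp add: term_nf_summands t(2) o_def)
  also have "map (\<lambda>i. term_nf (g i)) xs = map (\<lambda>i. {#i#}) xs"
    using g xs by (intro map_cong) auto
  also have "sum_list (map (\<lambda>i. {#i#}) xs) = mset xs"
    by (induction xs) simp_all
  finally show ?thesis using t(1) xs by blast
qed

lemma PT_id_of_reduced_atom:
  "reduced_atom X i \<Longrightarrow>
    \<exists>u\<in>PT_id X. u \<noteq> Hat0 \<and> (\<forall>a b. u \<noteq> a \<^bold>+ b) \<and> term_nf u = {#i#}"
proof (induction rule: reduced_atom.induct)
  case Unit
  show ?case by (intro bexI[of _ Hat1]) (auto simp: PT_id_def intro: PT.intros ST_id.intros)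
next
  case (Lead x q)
  then obtain t where t: "t \<in> PT_id X" "term_nf t = q"
    using PT_id_of_reduced_atoms[of q X] by (auto simp: reduced_def)
  have x: "Var x \<in> MT X"
    using Lead.hyps by (simp add: MT.intros)
  show ?case
  proof (cases "t = Hat1")
    case True
    with t x show ?thesis
      by (intro bexI[of _ "Var x"]) (auto simp: PT_id_def intro: PT.intros ST_id.intros)
  next
    case False
    have "t \<noteq> Hat0"
      using Lead.hyps t by auto
    with False t x Lead.hyps show ?thesis
      by (intro bexI[of _ "Var x \<^bold>* t"])
        (auto simp: PT_id_def nf_mult_generator intro: PT.product ST_id.product ST_id.monomial)
  qed
qed

lemma PT_id_of_reduced:
  assumes "reduced X q"
  shows "\<exists>t\<in>PT_id X. term_nf t = q"
  using assms by (intro PT_id_of_reduced_atoms ballI PT_id_of_reduced_atom) (simp_all add: reduced_def)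

lemma id_polynomials_iff: "p \<in> id_polynomials X \<longleftrightarrow> p \<in> polynomials X \<and> reduced X (nf p)"
proof
  assume "p \<in> id_polynomials X"
  then show "p \<in> polynomials X \<and> reduced X (nf p)"
    by (auto simp: id_polynomials_def PT_id_def nf_term reduced_term_nf)
next
  assume p: "p \<in> polynomials X \<and> reduced X (nf p)"
  then obtain t where "t \<in> PT_id X" "term_nf t = nf p"
    using PT_id_of_reduced by blast
  moreover from this have "p = [t]\<^sub>A\<^sub>C"
    using p by (metis IntD1 PT_id_def nf_class_nf nf_class_term_nf)
  ultimately show "p \<in> id_polynomials X"
    by (auto simp: id_polynomials_def)
qed

lemma nf_class_reduced:
  assumes "reduced X q"
  shows "nf_class q \<in> id_polynomials X" "nf (nf_class q) = q"
proof -
  obtain t where t: "t \<in> PT_id X" "term_nf t = q"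
    using assms PT_id_of_reduced by blast
  then have "nf_class q = [t]\<^sub>A\<^sub>C"
    using nf_class_term_nf[of t X] by (simp add: PT_id_def)
  with t show "nf_class q \<in> id_polynomials X" "nf (nf_class q) = q"
    by (auto simp: id_polynomials_def nf_term)
qed

lemma nf_class_single [simp]: "nf_class {#i#} = atom_class i"
  by simp

lemma nf_atom_class: "reduced_atom X i \<Longrightarrow> nf (atom_class i) = {#i#}"
  using nf_class_reduced(2)[of X "{#i#}"] by simp

lemma atom_class_summand:
  assumes "reduced_atom X i"
  shows "atom_class i \<in> {sb_one} \<union> monomials X \<union> (product_polynomials X \<inter> id_polynomials X)"
proof -
  obtain u where u: "u \<in> PT_id X" "u \<noteq> Hat0" "\<forall>a b. u \<noteq> a \<^bold>+ b" "term_nf u = {#i#}"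
    using PT_id_of_reduced_atom[OF assms] by blast
  then have "u \<in> PT X" by (simp add: PT_id_def)
  then have "[u]\<^sub>A\<^sub>C = atom_class i"
    using nf_class_term_nf[of u X] u(4) by simp
  moreover from \<open>u \<in> PT X\<close>
  have "[u]\<^sub>A\<^sub>C \<in> {sb_one} \<union> monomials X \<union> (product_polynomials X \<inter> id_polynomials X)"
    using u by cases (auto simp: monomials_def product_polynomials_def id_polynomials_def)
  ultimately show ?thesis by simp
qed

lemma summand_is_atom_class:
  assumes "p \<in> {sb_one} \<union> monomials X \<union> product_polynomials X"
  shows "\<exists>i. p = atom_class i \<and> nf p = {#i#}"
proof -
  have "\<exists>u\<in>PT X. u \<noteq> Hat0 \<and> (\<forall>a b. u \<noteq> a \<^bold>+ b) \<and> p = [u]\<^sub>A\<^sub>C"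
    using assms
    by (auto simp: monomials_def product_polynomials_def
        intro: PT.intros dest: MT_not_unit elim: MT.cases)
  then obtain u where u: "u \<in> PT X" "u \<noteq> Hat0" "\<forall>a b. u \<noteq> a \<^bold>+ b" "p = [u]\<^sub>A\<^sub>C"
    by blast
  then obtain i where "term_nf u = {#i#}"
    using term_nf_non_sum by blast
  with u nf_class_term_nf[OF u(1)] show ?thesis
    by (auto simp: nf_term)
qed

text \<open>
  Whatever decomposition is chosen, its members are classes of single atoms, and adding up their
  normal forms shows that these atoms are those of the normal form of \<open>q\<close>. That a decomposition
  exists follows by listing the atoms of \<open>nf q\<close>.
\<close>

lemma id_decomp_atoms:
  assumes "q \<in> id_polynomials X" "q \<noteq> sb_zero"
  shows "\<exists>xs. id_decomp X q = map atom_class xs \<and> mset xs = nf q"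
proof -
  let ?A = "{sb_one} \<union> monomials X \<union> (product_polynomials X \<inter> id_polynomials X)"
  have q: "q \<in> polynomials X" "reduced X (nf q)"
    using assms(1) by (simp_all add: id_polynomials_iff)
  obtain js where js: "mset js = nf q"
    using ex_mset by blast
  have red: "reduced_atom X i" if "i \<in> set js" for i
    using q(2) that unfolding js[symmetric] by (simp add: reduced_def)
  have sum_js: "sb_sum (map atom_class js) = q"
    using nf_class_nf[OF q(1)] by (simp add: js flip: nf_class_mset)
  have "distinct js"
    using q(2) by (simp add: js[symmetric] distinct_if_reduced)
  moreover have "inj_on atom_class (set js)"
    using nf_atom_class red by (metis inj_onI single_eq_single)
  ultimately have "distinct (map atom_class js)"
    by (simp add: distinct_map)
  moreover have "map atom_class js \<noteq> []"
    using sum_js assms(2) by auto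
  moreover have "set (map atom_class js) \<subseteq> ?A"
    using atom_class_summand red by auto
  ultimately have "\<exists>qs. qs \<noteq> [] \<and> distinct qs \<and> set qs \<subseteq> ?A \<and> sb_sum qs = q"
    using sum_js by blast
  then have sub: "set (id_decomp X q) \<subseteq> ?A" and sum: "sb_sum (id_decomp X q) = q"
    unfolding id_decomp_def by (rule someI2_ex, blast)+
  have "\<exists>i. p = atom_class i \<and> nf p = {#i#}" if "p \<in> set (id_decomp X q)" for p
    using summand_is_atom_class[of p X] sub that by blast
  then obtain g where g: "\<And>p. p \<in> set (id_decomp X q) \<Longrightarrow> p = atom_class (g p) \<and> nf p = {#g p#}"
    by metis
  define xs where "xs = map g (id_decomp X q)"
  have eq: "id_decomp X q = map atom_class xs"
    unfolding xs_def using g by (simp add: map_idI)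
  have A_poly: "?A \<subseteq> polynomials X"
    using monomials_subset_polynomials product_polynomials_subset_polynomials by fastforce
  have "nf (sb_sum qs) = mset (map g qs)" if "set qs \<subseteq> set (id_decomp X q)" for qs
    using that
  proof (induction qs)
    case Nil
    then show ?case by (simp add: nf_term)
  next
    case (Cons p qs)
    have "set qs \<subseteq> polynomials X" "p \<in> polynomials X"
      using Cons.prems sub A_poly by auto
    with Cons g[of p] show ?case
      by (simp add: nf_add[of _ X] sb_sum_polynomials)
  qed
  from this[of "id_decomp X q"] have "mset xs = nf q"
    using sum by (simp add: xs_def)
  with eq show ?thesis by blast
qed

text \<open>
  Dropping from the decomposition of \<open>r\<close> the summands that already occur in \<open>q\<close> amounts to
  forming the union of the two multisets of atoms.
\<close>

lemma add_id_eq: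
  assumes "q \<in> id_polynomials X" "r \<in> id_polynomials X"
  shows "add_id X q r = nf_class (nf q \<union># nf r)"
proof (cases "q = sb_zero \<or> r = sb_zero")
  case True
  then show ?thesis
    using assms by (auto simp: add_id_def nf_term nf_class_nf id_polynomials_iff)
next
  case False
  obtain xs where xs: "id_decomp X q = map atom_class xs" "mset xs = nf q"
    using id_decomp_atoms[OF assms(1)] False by blast
  obtain js where js: "id_decomp X r = map atom_class js" "mset js = nf r"
    using id_decomp_atoms[OF assms(2)] False by blast
  have red: "reduced X (nf q)" "reduced X (nf r)"
    using assms by (simp_all add: id_polynomials_iff)
  have red_atom: "reduced_atom X i" if "i \<in> set xs \<union> set js" for i
    using red that unfolding xs(2)[symmetric] js(2)[symmetric] by (auto simp: reduced_def)
  have "atom_class j \<in> set (map atom_class xs) \<longleftrightarrow> j \<in> set xs" if "j \<in> set js" for j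
  proof
    assume "atom_class j \<in> set (map atom_class xs)"
    then obtain i where "i \<in> set xs" "atom_class j = atom_class i"
      by auto
    then show "j \<in> set xs"
      using that red_atom[of i] red_atom[of j] nf_atom_class[of X i] nf_atom_class[of X j] by simp
  qed simp
  then have "filter (\<lambda>p. p \<notin> set (map atom_class xs)) (map atom_class js) =
      map atom_class (filter (\<lambda>j. j \<notin> set xs) js)"
    by (simp add: filter_map o_def cong: filter_cong)
  then have "add_id X q r = sb_sum (map atom_class (xs @ filter (\<lambda>j. j \<notin> set xs) js))"
    using False by (simp add: add_id_def Let_def xs(1) js(1) del: set_map)
  also have "\<dots> = nf_class (nf q + filter_mset (\<lambda>j. j \<notin># nf q) (nf r))"
    unfolding nf_class_mset[symmetric] xs(2)[symmetric] js(2)[symmetric] by simp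
  also have "nf q + filter_mset (\<lambda>j. j \<notin># nf q) (nf r) = nf q \<union># nf r"
  proof (rule reduced_eqI)
    show "reduced X (nf q + filter_mset (\<lambda>j. j \<notin># nf q) (nf r))"
      using red by (intro reduced_plus_disjoint) (auto simp: reduced_def)
  qed (use red in \<open>auto simp: reduced_union\<close>)
  finally show ?thesis .
qed

lemma add_id_closed:
  assumes "q \<in> id_polynomials X" "r \<in> id_polynomials X"
  shows "add_id X q r \<in> id_polynomials X" "nf (add_id X q r) = nf q \<union># nf r"
proof -
  have "reduced X (nf q \<union># nf r)"
    using assms by (simp add: id_polynomials_iff reduced_union)
  then show "add_id X q r \<in> id_polynomials X" "nf (add_id X q r) = nf q \<union># nf r"
    using assms by (simp_all add: add_id_eq nf_class_reduced)
qed

lemma mult_rd_id_polynomials: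
  "q \<in> id_polynomials X \<Longrightarrow> r \<in> id_polynomials X \<Longrightarrow> mult_rd X q r \<in> id_polynomials X"
  by (simp add: id_polynomials_iff mult_rd_polynomials nf_mult_rd reduced_nf_mult)

lemma zero_one_in_id_polynomials: "sb_zero \<in> id_polynomials X" "sb_one \<in> id_polynomials X"
  by (simp_all add: id_polynomials_iff nf_term reduced_atom.Unit)

lemma gens_subset_id_polynomials: "gens X \<subseteq> id_polynomials X"
  by (auto simp: gens_def id_polynomials_iff nf_term reduced_atom.Unit
      intro!: class_in_polynomials PT.monomial MT.intros)

section \<open>The free idempotent right-distributive strong bimonoid\<close>

theorem idem_rd_strong_bimonoid_B_id_rd: "idem_rd_strong_bimonoid (B_id_rd X)"
proof (rule idem_rd_strong_bimonoid_embedding[OF idem_rd_strong_bimonoid_reduced_nf_ring])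
  show "nf \<in> sb_hom (B_id_rd X) (reduced_nf_ring X)"
    by (auto simp: sb_hom_def ring_hom_def B_id_rd_def reduced_nf_ring_def add_id_closed
        id_polynomials_iff nf_mult_rd nf_term)
  show "inj_on nf (carrier (B_id_rd X))"
    by (rule inj_on_subset[OF inj_on_nf[of X]]) (auto simp: B_id_rd_def id_polynomials_iff)
qed (auto simp: B_id_rd_def intro: add_id_closed mult_rd_id_polynomials zero_one_in_id_polynomials)

text \<open>
  In a reduced multiset the atom \<open>i\<close> is not among the others, so adding it with \<open>add_id\<close> loses
  nothing.
\<close>

lemma nf_class_generated:
  assumes "\<forall>i\<in>#q. atom_class i \<in> sb_generate (B_id_rd X) (gens X)" "reduced X q"
  shows "nf_class q \<in> sb_generate (B_id_rd X) (gens X)"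
  using assms
proof (induction q)
  case empty
  show ?case using sb_generate.zero[of "B_id_rd X"] by (simp add: B_id_rd_def)
next
  case (add i q)
  then have i: "reduced_atom X i" "i \<notin># q" "reduced X q"
    by (simp_all add: reduced_add_mset)
  have "{#i#} \<union># q = add_mset i q"
    using add.prems(2) i by (intro reduced_eqI[of X] reduced_union) simp_all
  then have "nf_class (add_mset i q) = atom_class i \<oplus>\<^bsub>B_id_rd X\<^esub> nf_class q"
    using add_id_eq[of "nf_class {#i#}" X "nf_class q"] nf_class_reduced[of X "{#i#}"]
      nf_class_reduced[of X q] i by (simp add: B_id_rd_def)
  with add show ?case
    using i by (simp add: sb_generate.add)
qed

lemma atom_class_generated:
  "reduced_atom X i \<Longrightarrow> atom_class i \<in> sb_generate (B_id_rd X) (gens X)"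
proof (induction rule: reduced_atom.induct)
  case Unit
  show ?case using sb_generate.one[of "B_id_rd X"] by (simp add: B_id_rd_def)
next
  case (Lead x q)
  then have "nf_class q \<in> sb_generate (B_id_rd X) (gens X)"
    by (intro nf_class_generated) (auto simp: reduced_def)
  moreover have "[Var x]\<^sub>A\<^sub>C \<in> gens X"
    using Lead.hyps by (auto simp: gens_def)
  moreover from this have "atom_class (Lead x q) = [Var x]\<^sub>A\<^sub>C \<otimes>\<^bsub>B_id_rd X\<^esub> nf_class q"
    by (simp add: B_id_rd_def atom_class_Lead monomial_mult_rd subsetD[OF gens_subset_monomials])
  ultimately show ?case
    by (simp add: sb_generate.base sb_generate.mult)
qed

text \<open>
  With \<open>a\<close> and \<open>b\<close> the two normal forms, \<open>a \<union># b = a + (b - a)\<close>. The common part of \<open>a\<close>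
  and \<open>b\<close> is a summand of \<open>a\<close>, hence by idempotency its value is absorbed by the value of \<open>a\<close>
  and may be added to that of \<open>b - a\<close>, which gives the value of \<open>b\<close>.
\<close>

lemma (in idem_rd_strong_bimonoid) class_val_add_id:
  assumes f: "f \<in> X \<rightarrow> carrier R" and "q \<in> id_polynomials X" "r \<in> id_polynomials X"
  shows "class_val R f (add_id X q r) = class_val R f q \<oplus> class_val R f r"
proof -
  let ?v = "\<lambda>a. class_val R f (nf_class a)"
  let ?a = "nf q" and ?b = "nf r"
  have red: "reduced X ?a" "reduced X ?b"
    using assms by (simp_all add: id_polynomials_iff)
  have sub: "nf_class c \<in> polynomials X" if "c \<subseteq># ?a \<or> c \<subseteq># ?b" for c
  proof -
    have "reduced X c"
      using red that unfolding reduced_def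
      by (meson le_trans mset_subset_eqD mset_subset_eq_count)
    then show ?thesis using nf_class_reduced(1)[of X c] by (simp add: id_polynomials_iff)
  qed
  have plus: "?v (c + d) = ?v c \<oplus> ?v d"
    if "c \<subseteq># ?a \<or> c \<subseteq># ?b" "d \<subseteq># ?a \<or> d \<subseteq># ?b" for c d
    using sub[OF that(1)] sub[OF that(2)] by (simp add: nf_class_plus class_val_add[OF f])
  have closed: "?v c \<in> carrier R" if "c \<subseteq># ?a \<or> c \<subseteq># ?b" for c
    using class_val_closed[OF f sub[OF that]] .
  have "?a = (?a \<inter># ?b) + (?a - ?b)"
    by (rule multiset_eqI) simp
  then have va: "?v ?a = ?v (?a \<inter># ?b) \<oplus> ?v (?a - ?b)"
    using plus[of "?a \<inter># ?b" "?a - ?b"] by simp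
  have "?b = (?a \<inter># ?b) + (?b - ?a)"
    by (rule multiset_eqI) simp
  then have vb: "?v ?b = ?v (?a \<inter># ?b) \<oplus> ?v (?b - ?a)"
    using plus[of "?a \<inter># ?b" "?b - ?a"] by simp
  have "?v ?a \<oplus> ?v (?a \<inter># ?b) = (?v (?a \<inter># ?b) \<oplus> ?v (?a \<inter># ?b)) \<oplus> ?v (?a - ?b)"
    unfolding va using closed by (simp add: a_ac)
  then have absorb: "?v ?a \<oplus> ?v (?a \<inter># ?b) = ?v ?a"
    using closed by (simp add: add_idem flip: va)
  have "class_val R f (add_id X q r) = ?v (?a + (?b - ?a))"
    using assms by (simp add: add_id_eq union_mset_def)
  also have "\<dots> = ?v ?a \<oplus> ?v (?b - ?a)"
    by (rule plus) simp_all
  also have "\<dots> = (?v ?a \<oplus> ?v (?a \<inter># ?b)) \<oplus> ?v (?b - ?a)"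
    by (simp add: absorb)
  also have "\<dots> = ?v ?a \<oplus> ?v ?b"
    unfolding vb using closed by (simp add: a_assoc)
  finally show ?thesis
    using assms by (simp add: nf_class_nf[of _ X] id_polynomials_iff)
qed

theorem freely_generated_B_id_rd:
  "freely_generated (idem_rd_strong_bimonoid :: 'b ring \<Rightarrow> bool) (B_id_rd X) (gens X)"
proof -
  interpret idem_rd_strong_bimonoid "B_id_rd X"
    by (rule idem_rd_strong_bimonoid_B_id_rd)
  have gens: "gens X \<subseteq> carrier (B_id_rd X)"
    using gens_subset_id_polynomials by (simp add: B_id_rd_def)
  have "p \<in> carrier (B_id_rd X)" if "p \<in> sb_generate (B_id_rd X) (gens X)" for p
    using that gens by induction auto
  moreover have "p \<in> sb_generate (B_id_rd X) (gens X)" if "p \<in> id_polynomials X" for p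
    using that nf_class_generated[of "nf p" X] atom_class_generated[of X]
    by (auto simp: id_polynomials_iff nf_class_nf reduced_def)
  ultimately have "sb_generate (B_id_rd X) (gens X) = carrier (B_id_rd X)"
    by (auto simp: B_id_rd_def)
  moreover have "\<exists>h\<in>sb_hom (B_id_rd X) A. \<forall>y\<in>gens X. h y = f y"
    if "idem_rd_strong_bimonoid A" "f \<in> gens X \<rightarrow> carrier A" for A :: "'b ring" and f
  proof -
    interpret A: idem_rd_strong_bimonoid A by fact
    have g: "(\<lambda>x. f [Var x]\<^sub>A\<^sub>C) \<in> X \<rightarrow> carrier A"
      using that(2) by (auto simp: gens_def)
    have "class_val A (\<lambda>x. f [Var x]\<^sub>A\<^sub>C) \<in> sb_hom (B_id_rd X) A"
      using A.class_val_closed[OF g] A.class_val_add_id[OF g] A.class_val_mult_rd[OF g]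
        A.class_val_zero[OF g] A.class_val_one[OF g]
      by (auto simp: sb_hom_def ring_hom_def B_id_rd_def id_polynomials_iff)
    moreover have "\<forall>y\<in>gens X. class_val A (\<lambda>x. f [Var x]\<^sub>A\<^sub>C) y = f y"
      using A.class_val_Var[OF g] by (auto simp: gens_def)
    ultimately show ?thesis by blast
  qed
  ultimately show ?thesis
    using gens by (simp add: freely_generated_def)
qed

theorem theorem5p2:
  fixes X :: "'x set"
  assumes "X \<noteq> {}"
  shows "(rd_strong_bimonoid (N_rd X) \<and>
          freely_generated (rd_strong_bimonoid :: 'b ring \<Rightarrow> bool) (N_rd X) (gens X)) \<and>
         (idem_rd_strong_bimonoid (B_id_rd X) \<and>
          freely_generated (idem_rd_strong_bimonoid :: 'b ring \<Rightarrow> bool) (B_id_rd X) (gens X))"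
  using rd_strong_bimonoid_N_rd freely_generated_N_rd
    idem_rd_strong_bimonoid_B_id_rd freely_generated_B_id_rd by blast

end
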